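(* Let $\Phi$ and $\overline{\Phi}$ be Young functions and $\kappa>0$ such that for every $t>0$, \[ \Phi^{-1}(t)\,\overline{\Phi}^{-1}(t)\leq\kappa t . \] Then for every $p>1$ there is a constant $C>0$, depending only on $p$ and $\kappa$, such that for all weights $w$ and $\sigma$ on $\mathbb{R}$ and every $f\in L^p(\sigma)$, \[ \|M^{+}(f\sigma)\|_{L^{p}(w)}\leq C\left([\sigma,\overline{\Phi}]_{W_{p}^{-}}\,[w,\sigma,\Phi]_{A_{p}^{+}}\right)^{\frac{1}{p}}\|f\|_{L^{p}(\sigma)}. \]
   Context: A weight is a nonnegative measurable function on $\mathbb{R}$; $w(E)=\int_E w$, $\|f\|_{L^p(w)}=(\int_{\mathbb{R}}|f|^pw)^{1/p}$, and $p'=\frac{p}{p-1}$. $M^{+}f(x)=\sup_{h>0}\frac{1}{h}\int_{x}^{x+h}|f(y)|\,dy$. A Young function is a function $\Phi:[0,\infty)\to[0,\infty)$ that is continuous, convex and satisfies $\Phi(0)=0$; $\Phi^{-1}$ denotes its (generalized) inverse. For an interval $I$ the Luxemburg average is \[ \|f\|_{\Phi,I}=\inf\left\{\lambda>0:\ \frac{1}{|I|}\int_{I}\Phi\left(\frac{|f(x)|}{\lambda}\right)dx\leq1\right\}, \] and $M_{\Phi}^{+}f(x)=\sup_{h>0}\|f\|_{\Phi,(x,x+h)}$. For $p>1$, a Young function $\Phi$ and weights $w,\sigma$, \[ [\sigma,\Phi]_{W_{p}^{-}}=\sup_{I}\frac{1}{\sigma(I)}\int_{I}\left(M_{\Phi}^{+}\big(\sigma^{\frac{1}{p}}\chi_{I}\big)\right)^{p},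 \] where the supremum is over all bounded intervals $I$, and \[ [w,\sigma,\Phi]_{A_{p}^{+}}=\sup_{a<b<c}\frac{w(a,b)}{c-a}\,\|\sigma^{\frac{1}{p'}}\chi_{(b,c)}\|_{\Phi,(a,c)}^{p}. \] *)

theory Defs
  imports "HOL-Analysis.Analysis"
begin

definition weight :: "(real \<Rightarrow> real) \<Rightarrow> bool" where
  "weight w \<longleftrightarrow> w \<in> borel_measurable lebesgue \<and> (\<forall>x. 0 \<le> w x)"

definition weight_of :: "(real \<Rightarrow> real) \<Rightarrow> real set \<Rightarrow> ennreal" where
  "weight_of w E = (\<integral>\<^sup>+x\<in>E. ennreal (w x) \<partial>lebesgue)"

(* Only used for exponents r > 0, where 0 and infinity are fixed. *)
definition ennpowr :: "ennreal \<Rightarrow> real \<Rightarrow> ennreal" where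
  "ennpowr x r = (if x = \<infinity> then \<infinity> else ennreal (enn2real x powr r))"

definition conj_exp :: "real \<Rightarrow> real" where
  "conj_exp p = p / (p - 1)"

(* The argument is the modulus of the function whose norm is taken, so that
   maximal functions, which may be infinite, are covered. *)
definition Lp_norm :: "real \<Rightarrow> (real \<Rightarrow> real) \<Rightarrow> (real \<Rightarrow> ennreal) \<Rightarrow> ennreal" where
  "Lp_norm p w g = ennpowr (\<integral>\<^sup>+x. ennpowr (g x) p * ennreal (w x) \<partial>lebesgue) (1 / p)"

definition in_Lp :: "real \<Rightarrow> (real \<Rightarrow> real) \<Rightarrow> (real \<Rightarrow> real) \<Rightarrow> bool" where
  "in_Lp p w f \<longleftrightarrow> f \<in> borel_measurable lebesgue \<and> Lp_norm p w (\<lambda>x. ennreal \<bar>f x\<bar>) < \<infinity>"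

definition maximal_plus :: "(real \<Rightarrow> real) \<Rightarrow> real \<Rightarrow> ennreal" where
  "maximal_plus f x =
     (SUP h\<in>{0<..}. (\<integral>\<^sup>+y\<in>{x..x + h}. ennreal \<bar>f y\<bar> \<partial>lebesgue) / ennreal h)"

(* Values at negative arguments are irrelevant. *)
definition young_function :: "(real \<Rightarrow> real) \<Rightarrow> bool" where
  "young_function \<Phi> \<longleftrightarrow>
     continuous_on {0..} \<Phi> \<and> convex_on {0..} \<Phi> \<and> \<Phi> 0 = 0 \<and> (\<forall>t\<ge>0. 0 \<le> \<Phi> t)"

(* Right-continuous generalized inverse. The infimum of the empty set is
   infinity, which happens only if \<Phi> vanishes on the half-line. *)
definition gen_inverse :: "(real \<Rightarrow> real) \<Rightarrow> real \<Rightarrow> ennreal" where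
  "gen_inverse \<Phi> t = (INF s\<in>{s. 0 \<le> s \<and> t < \<Phi> s}. ennreal s)"

(* The infimum of the empty set is infinity. *)
definition luxemburg :: "(real \<Rightarrow> real) \<Rightarrow> (real \<Rightarrow> real) \<Rightarrow> real set \<Rightarrow> ennreal" where
  "luxemburg \<Phi> f I =
     (INF l\<in>{l. 0 < l \<and>
              (\<integral>\<^sup>+x\<in>I. ennreal (\<Phi> (\<bar>f x\<bar> / l)) \<partial>lebesgue) / emeasure lebesgue I \<le> 1}.
        ennreal l)"

definition maximal_young_plus :: "(real \<Rightarrow> real) \<Rightarrow> (real \<Rightarrow> real) \<Rightarrow> real \<Rightarrow> ennreal" where
  "maximal_young_plus \<Phi> f x = (SUP h\<in>{0<..}. luxemburg \<Phi> f {x<..<x + h})"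

(* Weights need not be locally integrable. In ennreal, 0 / 0 = 0, as intended for
   intervals with \<sigma>(I) = 0, but x / \<infinity> = 0 for every x, including \<infinity>. An interval
   with \<sigma>(I) = \<infinity> has to make the constant infinite: otherwise the constant would
   be 0 for a positive weight that is integrable on no interval of positive length. *)
definition W_minus_const :: "real \<Rightarrow> (real \<Rightarrow> real) \<Rightarrow> (real \<Rightarrow> real) \<Rightarrow> ennreal" where
  "W_minus_const p \<sigma> \<Phi> =
     (SUP I\<in>{I. is_interval I \<and> bounded I}.
        if weight_of \<sigma> I = \<infinity> then \<infinity>
        else (\<integral>\<^sup>+x\<in>I. ennpowr
                 (maximal_young_plus \<Phi> (\<lambda>y. \<sigma> y powr (1 / p) * indicator I y) x) p \<partial>lebesgue)
             / weight_of \<sigma> I)"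

definition A_plus_const ::
  "real \<Rightarrow> (real \<Rightarrow> real) \<Rightarrow> (real \<Rightarrow> real) \<Rightarrow> (real \<Rightarrow> real) \<Rightarrow> ennreal" where
  "A_plus_const p w \<sigma> \<Phi> =
     (SUP (a, b, c)\<in>{(a, b, c). a < b \<and> b < c}.
        weight_of w {a<..<b} / ennreal (c - a) *
        ennpowr (luxemburg \<Phi>
          (\<lambda>x. \<sigma> x powr (1 / conj_exp p) * indicator {b<..<c} x) {a<..<c}) p)"

end

theory Submission
  imports Defs
begin

text \<open>
  The proof splits the two-weight inequality into a testing inequality and a passage from
  testing to all functions. Throughout, integrals of a density over sets are handled as
  measures, and every passage from a family of intervals to its union goes through one
  covering inequality on the line (\<open>emeasure_Union_Ioo_le\<close>): if \<open>\<mu>(I) \<le> \<nu>(I)\<close> for all intervals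
  of the family, then the union has \<open>\<mu>\<close>-measure at most \<open>2 \<nu>(\<real>)\<close>. It holds for arbitrary
  measures, because a finite family of intervals has a subfamily with the same union in which
  no point is covered more than twice.

  Testing (\<open>testing_bound\<close>). Let \<open>I\<close> be an interval of finite \<open>\<sigma>\<close>-mass and let \<open>M\<close> be the maximal
  function of \<open>g = \<sigma> \<chi>\<^sub>I\<close>. At a point \<open>x\<close> with \<open>s < M x \<le> 2 s\<close> some interval \<open>(x, x + h)\<close> has
  average above \<open>s\<close>. As \<open>M x \<le> 2 s\<close>, the first quarter of this interval has mass at most \<open>s h / 2\<close>, so
  the rest \<open>J = (x + h/4, x + h)\<close> has mass at least \<open>s h / 2\<close>. Apply the Hoelder
  inequality for Luxemburg averages over \<open>(x - h/4, x + h)\<close> to the restrictions of \<open>\<sigma>\<^bsup>1/p'\<^esup>\<close> and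
  \<open>\<sigma>\<^bsup>1/p\<^esup> \<chi>\<^sub>I\<close> to \<open>J\<close>. Together with the \<open>A\<^sub>p\<^sup>+\<close> condition for \<open>x - h/4 < x + h/4 < x + h\<close> this bounds
  \<open>s\<^sup>p w(x - h/4, x + h/4)\<close> by a multiple of \<open>[w,\<sigma>,\<Phi>] h n\<^sup>p\<close>, where \<open>n\<close> is the Luxemburg average of
  \<open>\<sigma>\<^bsup>1/p\<^esup> \<chi>\<^sub>I \<chi>\<^sub>J\<close>. The gap \<open>(x, x + h/4)\<close> pays for this: \<open>n\<close> is a lower bound of the Luxemburg maximal
  function there, and at least half of the gap lies in \<open>I \<inter> {s/4 < M \<le> 16 s}\<close>. These level sets
  overlap at most seven times when \<open>s\<close> runs through the powers of 2, so summing over \<open>s\<close> gives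
  \<open>\<integral>\<^sub>I M\<^sup>p w \<le> C [w,\<sigma>,\<Phi>] \<integral>\<^sub>I (M\<^sub>\<Psi>\<^sup>+ (\<sigma>\<^bsup>1/p\<^esup> \<chi>\<^sub>I))\<^sup>p \<le> C [w,\<sigma>,\<Phi>] [\<sigma>,\<Psi>] \<sigma>(I)\<close>.

  From testing to all functions (\<open>testing_imp_strong_type\<close>). Write the average of \<open>|f| \<sigma>\<close> over
  \<open>(x, x + h)\<close> as \<open>\<sigma>(x, x + h) / h\<close> times the \<open>\<sigma>\<close>-average \<open>c\<close> of \<open>|f|\<close>. If \<open>2\<^sup>l < c \<le> 2\<^bsup>l+1\<^esup>\<close>, then
  \<open>(x, x + h)\<close> lies in one component \<open>L\<close> of the union \<open>U\<^sub>l\<close> of all intervals with \<open>\<sigma>\<close>-average above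
  \<open>2\<^sup>l\<close>, and the first factor is at most the maximal function of \<open>\<sigma> \<chi>\<^sub>L\<close> at \<open>x\<close>. Hence
  \<open>(M\<^sup>+(f \<sigma>))\<^sup>p\<close> is dominated pointwise by a sum over \<open>l\<close> and over the components of \<open>U\<^sub>l\<close> to which
  testing applies, and there remains \<open>\<Sum>\<^sub>l 2\<^bsup>l p\<^esup> \<sigma>(U\<^sub>l) \<le> C \<integral> |f|\<^sup>p \<sigma>\<close>, the usual truncation argument
  for the uncentred maximal function of the measure \<open>\<sigma>\<close>, which is of weak type (1,1) by the
  covering inequality.

  If the constant of \<open>\<sigma>\<close> is infinite, the right-hand side is infinite unless the norm of \<open>f\<close> or
  the constant of the pair of weights is 0; in both cases the left-hand side vanishes
  (\<open>A_plus_const_eq_0_imp\<close>).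
\<close>

section \<open>Powers of extended nonnegative reals\<close>

lemma ennpowr_ennreal: "0 \<le> x \<Longrightarrow> ennpowr (ennreal x) r = ennreal (x powr r)"
  by (simp add: ennpowr_def)

lemma ennpowr_0 [simp]: "ennpowr 0 r = 0"
  by (simp add: ennpowr_def)

lemma ennpowr_top [simp]: "ennpowr top r = top"
  by (simp add: ennpowr_def)

lemma ennpowr_one [simp]: "ennpowr x 1 = x"
  by (cases x rule: ennreal_cases) (auto simp: ennpowr_ennreal)

lemma ennpowr_mono:
  assumes "x \<le> y" and "0 < r"
  shows "ennpowr x r \<le> ennpowr y r"
  using assms
  by (cases x rule: ennreal_cases; cases y rule: ennreal_cases)
    (auto simp: ennpowr_ennreal powr_mono2 top_unique)

lemma ennpowr_mult:
  assumes "0 < r"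
  shows "ennpowr (x * y) r = ennpowr x r * ennpowr y r"
proof (cases x rule: ennreal_cases)
  case (real a)
  show ?thesis
  proof (cases y rule: ennreal_cases)
    case (real b)
    with \<open>x = ennreal a\<close> \<open>0 \<le> a\<close> show ?thesis
      by (simp add: ennpowr_ennreal powr_mult flip: ennreal_mult)
  next
    case top
    with \<open>x = ennreal a\<close> \<open>0 \<le> a\<close> show ?thesis
      by (cases "a = 0") (auto simp: ennpowr_ennreal ennreal_mult_top)
  qed
next
  case top
  show ?thesis
  proof (cases y rule: ennreal_cases)
    case (real b)
    with top show ?thesis
      by (cases "b = 0") (auto simp: ennpowr_ennreal ennreal_top_mult)
  qed (simp add: top)
qed

lemma ennpowr_ennpowr:
  assumes "0 < a" and "0 < b"
  shows "ennpowr (ennpowr x a) b = ennpowr x (a * b)"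
  by (cases x rule: ennreal_cases) (auto simp: ennpowr_ennreal powr_powr)

lemma ennpowr_eq_0_iff: "0 < r \<Longrightarrow> ennpowr x r = 0 \<longleftrightarrow> x = 0"
  by (cases x rule: ennreal_cases) (auto simp: ennpowr_ennreal)

lemma ennpowr_le_iff:
  assumes "0 < r"
  shows "ennpowr x r \<le> y \<longleftrightarrow> x \<le> ennpowr y (1 / r)"
proof
  assume "ennpowr x r \<le> y"
  from ennpowr_mono[OF this, of "1 / r"] show "x \<le> ennpowr y (1 / r)"
    using assms by (simp add: ennpowr_ennpowr)
next
  assume "x \<le> ennpowr y (1 / r)"
  from ennpowr_mono[OF this, of r] show "ennpowr x r \<le> y"
    using assms by (simp add: ennpowr_ennpowr)
qed

text \<open>
  Powers commute with suprema because raising to the power \<open>1 / r\<close> is the inverse; only the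
  resulting comparison is stated.
\<close>

lemma ennpowr_SUP_le_iff:
  assumes "0 < r"
  shows "ennpowr (SUP i\<in>I. g i) r \<le> y \<longleftrightarrow> (\<forall>i\<in>I. ennpowr (g i) r \<le> y)"
  using assms by (simp add: ennpowr_le_iff SUP_le_iff)

lemma ennpowr_measurable [measurable]:
  assumes [measurable]: "g \<in> borel_measurable M"
  shows "(\<lambda>x. ennpowr (g x) r) \<in> borel_measurable M"
  unfolding ennpowr_def by measurable

lemma ennreal_less_divide_iff:
  fixes t x :: ennreal
  assumes "0 < h"
  shows "t < x / ennreal h \<longleftrightarrow> t * ennreal h < x"
proof -
  have "t * ennreal h < x \<longleftrightarrow> \<not> x \<le> ennreal h * t" by (simp add: not_le mult.commute)
  also have "x \<le> ennreal h * t \<longleftrightarrow> x / ennreal h \<le> t"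
    using assms divide_le_posI_ennreal[of "ennreal h" x t]
      mult_left_mono[of "x / ennreal h" t "ennreal h"]
    by (auto simp: ennreal_mult_divide_eq ennreal_times_divide mult_divide_eq_ennreal mult.commute)
  finally show ?thesis by (simp add: not_le)
qed

lemma ennreal_divide_mult_cancel:
  assumes "0 < h"
  shows "x / ennreal h * ennreal h = x"
  using assms by (simp add: ennreal_divide_times ennreal_divide_self)

text \<open>
  The product with an infimum is delicate at the ends: for \<open>K = 0\<close> and empty \<open>S\<close> the right-hand side
  is 0, and for \<open>K = \<infinity>\<close> the infimum may be 0 without being attained.
\<close>

lemma ennreal_le_mult_INF:
  fixes K :: ennreal
  assumes "K \<noteq> 0" "K \<noteq> top" and le: "\<And>l. l \<in> S \<Longrightarrow> x \<le> K * g l"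
  shows "x \<le> K * (INF l\<in>S. g l)"
proof -
  have "x / K \<le> (INF l\<in>S. g l)"
    using assms by (intro INF_greatest divide_le_posI_ennreal) (auto simp: zero_less_iff_neq_zero)
  then have "K * (x / K) \<le> K * (INF l\<in>S. g l)" by (rule mult_left_mono) simp
  moreover have "K * (x / K) = x"
    using assms by (metis ennreal_mult_divide_eq ennreal_times_divide mult.commute)
  ultimately show ?thesis by simp
qed

section \<open>A covering inequality for intervals\<close>

text \<open>
  Take a subfamily of least cardinality with the same union. Among three of its intervals
  through \<open>x\<close>, the one reaching furthest left and the one reaching furthest right cover the
  third, which could be dropped.
\<close>

lemma finite_interval_cover_overlap:
  fixes F :: "(real \<times> real) set"
  assumes "finite F"
  shows "\<exists>F'\<subseteq>F. (\<Union>i\<in>F'. {fst i<..<snd i}) = (\<Union>i\<in>F. {fst i<..<snd i}) \<and>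
           (\<forall>x. card {i \<in> F'. x \<in> {fst i<..<snd i}} \<le> 2)"
proof -
  let ?I = "\<lambda>i :: real \<times> real. {fst i<..<snd i}"
  let ?U = "\<lambda>F. \<Union>i\<in>F. ?I i"
  let ?Q = "\<lambda>F'. F' \<subseteq> F \<and> ?U F' = ?U F"
  define F' where "F' = (ARG_MIN card G. ?Q G)"
  have Q: "?Q F'" and minimal: "\<And>G. ?Q G \<Longrightarrow> card F' \<le> card G"
    unfolding F'_def using arg_min_nat_lemma[of ?Q F card] by blast+
  have fin: "finite F'" using Q assms finite_subset by blast
  have "card {i \<in> F'. x \<in> {fst i<..<snd i}} \<le> 2" for x
  proof (rule ccontr)
    define X where "X = {i \<in> F'. x \<in> {fst i<..<snd i}}"
    assume "\<not> card {i \<in> F'. x \<in> {fst i<..<snd i}} \<le> 2"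
    then have card: "card X > 2" by (simp add: X_def)
    have X: "X \<subseteq> F'" by (auto simp: X_def)
    have X': "finite X" using X fin finite_subset by blast
    have X'': "X \<noteq> {}" using card by auto
    obtain l where l: "l \<in> X" "\<And>i. i \<in> X \<Longrightarrow> fst l \<le> fst i"
    proof -
      have "Min (fst ` X) \<in> fst ` X" using X' X'' by simp
      then obtain l where "l \<in> X" "fst l = Min (fst ` X)" by (metis imageE)
      then show ?thesis using that X' by simp
    qed
    obtain r where r: "r \<in> X" "\<And>i. i \<in> X \<Longrightarrow> snd i \<le> snd r"
    proof -
      have "Max (snd ` X) \<in> snd ` X" using X' X'' by simp
      then obtain r where "r \<in> X" "snd r = Max (snd ` X)" by (metis imageE)
      then show ?thesis using that X' by simp
    qed
    have "card {l, r} \<le> 2" by (simp add: card_insert_if)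
    then have "\<not> X \<subseteq> {l, r}"
      using card card_mono[of "{l, r}" X] by auto
    then obtain k where k: "k \<in> X" "k \<noteq> l" "k \<noteq> r" by auto
    have lr: "fst l < x" "x < snd l" "fst r < x" "x < snd r"
      using l r by (auto simp: X_def)
    have sub: "{fst k<..<snd k} \<subseteq> {fst l<..<snd l} \<union> {fst r<..<snd r}"
      using l(2)[OF k(1)] r(2)[OF k(1)] lr by auto
    have lr': "l \<in> F' - {k}" "r \<in> F' - {k}" using k l r X by auto
    have "?I i \<subseteq> (\<Union>i\<in>F' - {k}. ?I i)" if "i \<in> F'" for i
      using sub lr' that by (cases "i = k") blast+
    then have "?U (F' - {k}) = ?U F'" by blast
    then have "?Q (F' - {k})" using Q by auto
    from minimal[OF this] show False
      using k(1) X fin card_Diff1_less[of F' k] by auto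
  qed
  then show ?thesis using Q by (intro exI[of _ F']) simp
qed

text \<open>
  Unlike covering arguments of Vitali type, this needs no doubling condition on the measures. The
  finite case integrates the overlap bound of the previous lemma; countably many intervals suffice
  since the line is a Lindeloef space.
\<close>

lemma emeasure_Union_Ioo_le:
  fixes \<mu> \<nu> :: "real measure" and F :: "(real \<times> real) set"
  assumes [measurable_cong, simp]: "sets \<mu> = sets lebesgue" "sets \<nu> = sets lebesgue"
  assumes le: "\<And>a b. (a, b) \<in> F \<Longrightarrow> emeasure \<mu> {a<..<b} \<le> emeasure \<nu> {a<..<b}"
  shows "emeasure \<mu> (\<Union>(a, b)\<in>F. {a<..<b}) \<le> 2 * emeasure \<nu> UNIV"
proof -
  let ?I = "\<lambda>i :: real \<times> real. {fst i<..<snd i}"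
  have meas [simp]: "?I i \<in> sets lebesgue" for i by simp
  have meas': "?I i \<in> sets \<nu>" for i by simp
  have finite_case: "emeasure \<mu> (\<Union>i\<in>G. ?I i) \<le> 2 * emeasure \<nu> UNIV"
    if "finite G" "G \<subseteq> F" for G
  proof -
    obtain H where H: "H \<subseteq> G" "(\<Union>i\<in>H. ?I i) = (\<Union>i\<in>G. ?I i)"
      "\<And>x. card {i \<in> H. x \<in> ?I i} \<le> 2"
      using finite_interval_cover_overlap[OF \<open>finite G\<close>] by blast
    have finH [simp]: "finite H" using finite_subset[OF H(1) that(1)] .
    have "emeasure \<mu> (\<Union>i\<in>G. ?I i) \<le> (\<Sum>i\<in>H. emeasure \<mu> (?I i))"
      unfolding H(2)[symmetric] by (rule emeasure_subadditive_finite) auto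
    also have "\<dots> \<le> (\<Sum>i\<in>H. emeasure \<nu> (?I i))"
      using H(1) that(2) le by (intro sum_mono) auto
    also have "\<dots> = (\<Sum>i\<in>H. \<integral>\<^sup>+x. indicator (?I i) x \<partial>\<nu>)"
      by (intro sum.cong refl nn_integral_indicator[symmetric] meas')
    also have "\<dots> = (\<integral>\<^sup>+x. (\<Sum>i\<in>H. indicator (?I i) x) \<partial>\<nu>)"
      by (rule nn_integral_sum[symmetric]) (rule borel_measurable_indicator[OF meas'])
    also have "\<dots> \<le> (\<integral>\<^sup>+x. 2 \<partial>\<nu>)"
    proof (rule nn_integral_mono)
      fix x
      have "(\<Sum>i\<in>H. indicator (?I i) x) = (\<Sum>i\<in>H. of_bool (x \<in> ?I i) :: ennreal)"
        by (simp only: indicator_def)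
      also have "\<dots> = of_nat (card (H \<inter> {i. x \<in> ?I i}))"
        by (rule sum_of_bool_eq[OF finH finH])
      also have "H \<inter> {i. x \<in> ?I i} = {i \<in> H. x \<in> ?I i}" by blast
      also have "of_nat (card {i \<in> H. x \<in> ?I i}) \<le> (of_nat 2 :: ennreal)" by (rule of_nat_mono) (rule H(3))
      finally show "(\<Sum>i\<in>H. indicator (?I i) x) \<le> (2 :: ennreal)" by simp
    qed
    also have "\<dots> = 2 * emeasure \<nu> UNIV"
      using sets_eq_imp_space_eq[of \<nu> lebesgue] by simp
    finally show ?thesis .
  qed
  obtain \<F> where \<F>: "\<F> \<subseteq> ?I ` F" "countable \<F>" "\<Union>\<F> = \<Union>(?I ` F)"
  proof (rule Lindelof[of "?I ` F"])
    show "open S" if "S \<in> ?I ` F" for S using that by (elim imageE) simp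
  qed (rule that)
  obtain G where G: "G \<subseteq> F" "countable G" "\<F> = ?I ` G"
    using countable_subset_image[of \<F> ?I F] \<F>(1,2) by metis
  have eq: "(\<Union>(a, b)\<in>F. {a<..<b}) = (\<Union>i\<in>G. ?I i)"
    using \<F>(3) G(3) by (auto simp: case_prod_beta)
  show ?thesis
  proof (cases "G = {}")
    case False
    define e where "e = from_nat_into G"
    have range: "range e = G" using False G(2) by (simp add: e_def)
    have "(\<Union>i\<in>G. ?I i) = (\<Union>n. \<Union>i\<in>e ` {..n}. ?I i)"
      unfolding range[symmetric] by auto
    also have "emeasure \<mu> \<dots> = (SUP n. emeasure \<mu> (\<Union>i\<in>e ` {..n}. ?I i))"
      by (rule SUP_emeasure_incseq[symmetric]) (auto simp: incseq_def, force)
    also have "\<dots> \<le> 2 * emeasure \<nu> UNIV"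
      using G(1) range by (intro SUP_least finite_case) auto
    finally show ?thesis unfolding eq .
  qed (simp add: eq)
qed

section \<open>Dyadic sums over the integers\<close>

lemma nn_integral_count_space_ge:
  assumes "i \<in> A"
  shows "f i \<le> (\<integral>\<^sup>+i. f i \<partial>count_space A)"
proof -
  have "f i = (\<integral>\<^sup>+j. f i * indicator {i} j \<partial>count_space A)"
    using assms by (simp add: nn_integral_cmult_indicator)
  also have "\<dots> \<le> (\<integral>\<^sup>+i. f i \<partial>count_space A)"
    by (intro nn_integral_mono) (auto simp: indicator_def)
  finally show ?thesis .
qed

lemma borel_measurable_nn_integral_count_space:
  fixes u :: "'i \<Rightarrow> 'a \<Rightarrow> ennreal"
  assumes "countable I" and [measurable]: "\<And>i. i \<in> I \<Longrightarrow> u i \<in> borel_measurable M"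
  shows "(\<lambda>x. \<integral>\<^sup>+i. u i x \<partial>count_space I) \<in> borel_measurable M"
proof (cases "finite I")
  case True
  then show ?thesis by (simp add: nn_integral_count_space_finite)
next
  case False
  then have "(\<integral>\<^sup>+i. u i x \<partial>count_space I) = (\<Sum>n. u (from_nat_into I n) x)" for x
    using nn_integral_bij_count_space[OF bij_betw_from_nat_into[OF \<open>countable I\<close>], of "\<lambda>i. u i x"]
    by (simp add: nn_integral_count_space_nat)
  moreover have "from_nat_into I n \<in> I" for n
    using False by (intro from_nat_into) auto
  ultimately show ?thesis by simp
qed

lemma dyadic_level:
  assumes "0 < t" and "t < top"
  obtains k :: int where "ennreal (2 powr real_of_int k) < t" "t \<le> ennreal (2 powr (real_of_int k + 1))"
proof -
  obtain r where r: "t = ennreal r" "0 < r"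
    using assms by (cases t rule: ennreal_cases) auto
  define k where "k = \<lceil>log 2 r\<rceil> - 1"
  have k: "real_of_int k < log 2 r" "log 2 r \<le> real_of_int k + 1"
    unfolding k_def by linarith+
  have "2 powr real_of_int k < r" using k(1) r(2) by (simp add: less_log_iff)
  moreover have "r \<le> 2 powr (real_of_int k + 1)" using k(2) r(2) by (simp add: log_le_iff)
  ultimately show ?thesis using r by (intro that[of k]) (auto simp: ennreal_less_iff ennreal_leI)
qed

text \<open>
  Each level set \<open>{s/4 < M \<le> 16 s}\<close> spans six octaves; the bound 7 leaves room for rounding the
  logarithm of \<open>t\<close> to an integer.
\<close>

lemma dyadic_overlap:
  "(\<integral>\<^sup>+k. of_bool (ennreal (2 powr real_of_int k / 4) < t \<and> t \<le> ennreal (16 * 2 powr real_of_int k))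
     \<partial>count_space (UNIV :: int set)) \<le> 7"
proof -
  let ?A = "{k :: int. ennreal (2 powr k / 4) < t \<and> t \<le> ennreal (16 * 2 powr k)}"
  have "finite ?A \<and> card ?A \<le> 7"
  proof (cases "0 < t \<and> t < top")
    case True
    then obtain r where r: "t = ennreal r" "0 < r"
      by (cases t rule: ennreal_cases) auto
    have "?A \<subseteq> {\<lceil>log 2 r\<rceil> - 4 .. \<lceil>log 2 r\<rceil> + 2}"
    proof
      fix k assume "k \<in> ?A"
      then have "2 powr k / 4 < r" "r \<le> 16 * 2 powr k"
        using r by (auto simp: ennreal_less_iff ennreal_le_iff)
      moreover have "2 powr k / 4 = 2 powr (real_of_int k - 2)" "16 * 2 powr k = 2 powr (real_of_int k + 4)"
        by (simp_all add: powr_diff powr_add)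
      ultimately have "real_of_int k - 2 < log 2 r" "log 2 r \<le> real_of_int k + 4"
        using r(2) by (simp_all add: less_log_iff log_le_iff)
      then show "k \<in> {\<lceil>log 2 r\<rceil> - 4 .. \<lceil>log 2 r\<rceil> + 2}"
        unfolding atLeastAtMost_iff by linarith
    qed
    then show ?thesis
      using finite_subset[of ?A "{\<lceil>log 2 r\<rceil> - 4 .. \<lceil>log 2 r\<rceil>
          + 2}"] card_mono[of "{\<lceil>log 2 r\<rceil> - 4 .. \<lceil>log 2 r\<rceil> + 2}" ?A] by simp
  next
    case False
    then have "t = 0 \<or> t = top" by (auto simp: zero_less_iff_neq_zero top.not_eq_extremum)
    then have "?A = {}" by (auto simp: top_unique)
    then show ?thesis by (simp only: finite.emptyI card.empty zero_le simp_thms)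
  qed
  then have A: "finite ?A" "card ?A \<le> 7" by auto
  have "(\<integral>\<^sup>+k. of_bool (ennreal (2 powr real_of_int k / 4) < t \<and> t \<le> ennreal (16 * 2 powr real_of_int k))
     \<partial>count_space UNIV) = (\<integral>\<^sup>+k. indicator ?A k \<partial>count_space UNIV)"
    by (intro nn_integral_cong) (simp add: indicator_def)
  also have "\<dots> = of_nat (card ?A)" using A(1) by simp
  also have "\<dots> \<le> of_nat 7" by (intro of_nat_mono A)
  finally show ?thesis by simp
qed

text \<open>
  The condition bounds \<open>k\<close> from above, so this is a geometric series with ratio \<open>2\<^bsup>-q\<^esup>\<close> whose
  largest term is below \<open>t\<^sup>q\<close>.
\<close>

lemma dyadic_geometric_sum:
  assumes "0 < q" and "0 \<le> t"
  shows "(\<integral>\<^sup>+k. ennreal (2 powr (real_of_int k * q)) * of_bool (2 powr real_of_int k < t) \<partial>count_space UNIV)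
    \<le> ennreal (t powr q / (1 - 2 powr (- q)))"
proof (cases "t = 0")
  case True
  then have "\<not> 2 powr real_of_int k < t" for k by (simp add: not_less)
  then show ?thesis by simp
next
  case False
  then have "0 < t" using assms by simp
  define j where "j = \<lceil>log 2 t\<rceil> - 1"
  define r where "r = (2::real) powr (- q)"
  have r: "0 \<le> r" "r < 1" unfolding r_def using \<open>0 < q\<close> by (auto simp: powr_less_one)
  have jt: "2 powr (real_of_int j * q) \<le> t powr q"
  proof -
    have "real_of_int j < log 2 t" unfolding j_def by linarith
    then have "2 powr real_of_int j < t" using \<open>0 < t\<close> by (simp add: less_log_iff)
    then have "(2 powr real_of_int j) powr q \<le> t powr q" using \<open>0 < q\<close> by (intro powr_mono2) auto
    then show ?thesis by (simp add: powr_powr)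
  qed
  have sub: "k \<le> j" if "2 powr real_of_int k < t" for k :: int
  proof -
    have "real_of_int k < log 2 t" using that \<open>0 < t\<close> by (simp add: less_log_iff)
    then show ?thesis unfolding j_def by linarith
  qed
  have "(\<integral>\<^sup>+k. ennreal (2 powr (real_of_int k * q)) * of_bool (2 powr real_of_int k < t) \<partial>count_space UNIV)
    \<le> (\<integral>\<^sup>+k. ennreal (2 powr (real_of_int k * q)) * indicator {..j} k \<partial>count_space UNIV)"
    using sub by (intro nn_integral_mono mult_left_mono) (auto simp: indicator_def)
  also have "\<dots> = (\<integral>\<^sup>+k. ennreal (2 powr (real_of_int k * q)) \<partial>count_space {..j})"
    by (simp add: nn_integral_count_space_indicator)
  also have "\<dots> = (\<integral>\<^sup>+n. ennreal (2 powr (real_of_int (j - int n) * q)) \<partial>count_space UNIV)"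
  proof (rule nn_integral_bij_count_space[symmetric])
    show "bij_betw (\<lambda>n. j - int n) UNIV {..j}"
      by (rule bij_betwI[where g = "\<lambda>k. nat (j - k)"]) auto
  qed
  also have "\<dots> = (\<Sum>n. ennreal (2 powr (real_of_int (j - int n) * q)))"
    by (rule nn_integral_count_space_nat)
  also have "\<dots> = (\<Sum>n. ennreal (2 powr (real_of_int j * q) * r ^ n))"
  proof -
    have "2 powr (real_of_int (j - int n) * q) = 2 powr (real_of_int j * q) * r ^ n" for n
    proof -
      have "real_of_int (j - int n) * q = real_of_int j * q + real n * (- q)" by (simp add: algebra_simps)
      then show ?thesis by (simp only: powr_add r_def powr_power)
    qed
    then show ?thesis by simp
  qed
  also have "\<dots> = ennreal (2 powr (real_of_int j * q) * (1 / (1 - r)))"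
    using r by (intro suminf_ennreal_eq sums_mult geometric_sums) auto
  also have "\<dots> \<le> ennreal (t powr q * (1 / (1 - r)))"
    using r by (intro ennreal_leI mult_right_mono jt) auto
  finally show ?thesis by (simp add: r_def)
qed

section \<open>The one-sided maximal function\<close>

definition integral_measure :: "(real \<Rightarrow> real) \<Rightarrow> real measure" where
  "integral_measure g = density lebesgue (\<lambda>x. ennreal \<bar>g x\<bar>)"

lemma sets_integral_measure [simp, measurable_cong]: "sets (integral_measure g) = sets lebesgue"
  by (simp add: integral_measure_def)

lemma space_integral_measure [simp]: "space (integral_measure g) = UNIV"
  by (simp add: integral_measure_def)

lemma Ioo_lebesgue [measurable]: "{a<..<b :: real} \<in> sets lebesgue"
  by simp

lemma nn_integral_Icc_eq_Ioo:
  fixes a b :: real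
  shows "(\<integral>\<^sup>+y\<in>{a..b}. g y \<partial>lebesgue) = (\<integral>\<^sup>+y\<in>{a<..<b}. g y \<partial>lebesgue)"
proof (rule nn_integral_cong_AE)
  have "{a, b} \<in> null_sets lebesgue"
    by (intro null_setsI) (auto simp: emeasure_lborel_countable)
  then have "AE x in lebesgue. x \<notin> {a, b}" by (rule AE_not_in)
  then show "AE x in lebesgue. g x * indicator {a..b} x = g x * indicator {a<..<b} x"
    by eventually_elim (auto simp: indicator_def)
qed

lemma emeasure_integral_measure:
  assumes "g \<in> borel_measurable lebesgue" and "E \<in> sets lebesgue"
  shows "emeasure (integral_measure g) E = (\<integral>\<^sup>+x\<in>E. ennreal \<bar>g x\<bar> \<partial>lebesgue)"
  using assms by (simp add: integral_measure_def emeasure_density)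

lemma emeasure_integral_measure_Icc:
  assumes "g \<in> borel_measurable lebesgue"
  shows "emeasure (integral_measure g) {a..b} = emeasure (integral_measure g) {a<..<b}"
  using assms by (simp add: emeasure_integral_measure nn_integral_Icc_eq_Ioo)

lemma emeasure_integral_measure_restrict:
  assumes [measurable]: "g \<in> borel_measurable lebesgue" "A \<in> sets lebesgue" "B \<in> sets lebesgue"
  shows "emeasure (integral_measure (\<lambda>y. g y * indicator B y)) A = emeasure (integral_measure g) (A \<inter> B)"
proof -
  have [measurable]: "(\<lambda>y. g y * indicator B y) \<in> borel_measurable lebesgue" by measurable
  have "A \<inter> B \<in> sets lebesgue" by measurable
  then show ?thesis
    by (subst (1 2) emeasure_integral_measure) (auto simp: indicator_def intro!: nn_integral_cong)
qed

lemma nn_integral_integral_measure: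
  assumes "g \<in> borel_measurable lebesgue" and "u \<in> borel_measurable lebesgue"
  shows "(\<integral>\<^sup>+x. u x \<partial>integral_measure g) = (\<integral>\<^sup>+x. u x * ennreal \<bar>g x\<bar> \<partial>lebesgue)"
  using assms by (simp add: integral_measure_def nn_integral_density mult.commute)

lemma emeasure_integral_measure_mult:
  assumes [measurable]: "f \<in> borel_measurable lebesgue" "\<sigma> \<in> borel_measurable lebesgue" "E \<in> sets lebesgue"
  shows "emeasure (integral_measure (\<lambda>x. f x * \<sigma> x)) E = (\<integral>\<^sup>+x\<in>E. ennreal \<bar>f x\<bar> \<partial>integral_measure \<sigma>)"
  by (simp add: emeasure_integral_measure nn_integral_integral_measure abs_mult ennreal_mult mult_ac)

lemma weight_of_eq_emeasure:
  assumes "weight \<sigma>" and "E \<in> sets lebesgue"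
  shows "weight_of \<sigma> E = emeasure (integral_measure \<sigma>) E"
  using assms by (simp add: weight_of_def weight_def emeasure_integral_measure)

lemma weight_of_mult_eq:
  assumes "weight \<sigma>" and f: "f \<in> borel_measurable lebesgue" and "E \<in> sets lebesgue"
  shows "weight_of (\<lambda>x. \<bar>f x\<bar> * \<sigma> x) E = emeasure (integral_measure (\<lambda>x. f x * \<sigma> x)) E"
    and "weight_of (\<lambda>x. \<bar>f x\<bar> * \<sigma> x) E = (\<integral>\<^sup>+x\<in>E. ennreal \<bar>f x\<bar> \<partial>integral_measure \<sigma>)"
proof -
  have "\<sigma> \<in> borel_measurable lebesgue" and nn: "\<And>x. 0 \<le> \<sigma> x" using assms(1) by (auto simp: weight_def)
  show "weight_of (\<lambda>x. \<bar>f x\<bar> * \<sigma> x) E = emeasure (integral_measure (\<lambda>x. f x * \<sigma> x)) E"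
    using \<open>\<sigma> \<in> _\<close> nn assms(2,3) by (simp add: weight_of_def emeasure_integral_measure abs_mult)
  then show "weight_of (\<lambda>x. \<bar>f x\<bar> * \<sigma> x) E = (\<integral>\<^sup>+x\<in>E. ennreal \<bar>f x\<bar> \<partial>integral_measure \<sigma>)"
    using emeasure_integral_measure_mult[OF f \<open>\<sigma> \<in> _\<close> assms(3)] by simp
qed

lemma maximal_plus_eq:
  assumes "g \<in> borel_measurable lebesgue"
  shows "maximal_plus g x = (SUP h\<in>{0<..}. emeasure (integral_measure g) {x<..<x + h} / ennreal h)"
  using assms by (simp add: maximal_plus_def emeasure_integral_measure nn_integral_Icc_eq_Ioo)

lemma maximal_plus_gt_iff:
  assumes "g \<in> borel_measurable lebesgue"
  shows "t < maximal_plus g x \<longleftrightarrow>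
    (\<exists>h>0. t * ennreal h < emeasure (integral_measure g) {x<..<x + h})"
  using assms by (auto simp: maximal_plus_eq less_SUP_iff ennreal_less_divide_iff)

lemma maximal_plus_ge:
  assumes "g \<in> borel_measurable lebesgue" and "0 < h"
  shows "emeasure (integral_measure g) {x<..<x + h} \<le> maximal_plus g x * ennreal h"
  using assms(2) maximal_plus_gt_iff[OF assms(1), of "maximal_plus g x" x] by (metis less_irrefl not_less)

lemma maximal_plus_eq_0:
  assumes g: "g \<in> borel_measurable lebesgue" and "AE x in lebesgue. g x = 0"
  shows "maximal_plus g x = 0"
proof -
  have "emeasure (integral_measure g) {x<..<x + h} = 0" for h
  proof -
    have "AE y in lebesgue. ennreal \<bar>g y\<bar> * indicator {x<..<x + h} y = 0"
      using assms(2) by eventually_elim simp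
    then have "(\<integral>\<^sup>+y. ennreal \<bar>g y\<bar> * indicator {x<..<x + h} y \<partial>lebesgue) = (\<integral>\<^sup>+y. 0
        \<partial>(lebesgue :: real measure))"
      by (rule nn_integral_cong_AE)
    then show ?thesis by (simp add: emeasure_integral_measure g)
  qed
  then show ?thesis by (simp add: maximal_plus_eq[OF g])
qed

lemma incseq_Ioo_left:
  fixes x b :: real
  shows "incseq (\<lambda>n. {x + inverse (real (Suc n))<..<b})" 
    and "(\<Union>n. {x + inverse (real (Suc n))<..<b}) = {x<..<b}"
proof -
  show "incseq (\<lambda>n. {x + inverse (real (Suc n))<..<b})"
  proof (intro incseq_SucI subsetI)
    fix n y assume y: "y \<in> {x + inverse (real (Suc n))<..<b}"
    have "inverse (real (Suc (Suc n))) \<le> inverse (real (Suc n))"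
      by (intro le_imp_inverse_le) auto
    then show "y \<in> {x + inverse (real (Suc (Suc n)))<..<b}"
      using y unfolding greaterThanLessThan_iff by linarith
  qed
  show "(\<Union>n. {x + inverse (real (Suc n))<..<b}) = {x<..<b}"
  proof safe
    fix y assume "y \<in> {x<..<b}"
    then obtain n where "inverse (real (Suc n)) < y - x"
      using reals_Archimedean[of "y - x"] by auto
    then show "y \<in> (\<Union>n. {x + inverse (real (Suc n))<..<b})"
      using \<open>y \<in> {x<..<b}\<close> by (intro UN_I[of n]) auto
  next
    fix y n assume y: "y \<in> {x + inverse (real (Suc n))<..<b}"
    have "0 < inverse (real (Suc n))" by simp
    then show "y \<in> {x<..<b}" using y unfolding greaterThanLessThan_iff by linarith
  qed
qed

text \<open>
  If the average over \<open>(x, x + h)\<close> exceeds \<open>t\<close>, then by continuity of measures from below the mass of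
  \<open>(x + \<delta>, x + h)\<close> already exceeds \<open>t h\<close>, even \<open>t (h + \<eta>)\<close>. This interval lies in \<open>(z, x + h)\<close> for all
  \<open>z\<close> near \<open>x\<close>, and \<open>(z, x + h)\<close> is shorter than \<open>h + \<eta>\<close>.
\<close>

lemma open_maximal_plus_gt:
  assumes g: "g \<in> borel_measurable lebesgue"
  shows "open {x. ennreal t < maximal_plus g x}"
proof (rule openI)
  let ?m = "emeasure (integral_measure g)"
  fix x assume "x \<in> {x. ennreal t < maximal_plus g x}"
  then obtain h where h: "0 < h" "ennreal t * ennreal h < ?m {x<..<x + h}"
    using g by (auto simp: maximal_plus_gt_iff)
  have "?m {x<..<x + h} = (SUP n. ?m {x + inverse (real (Suc n))<..<x + h})"
    unfolding incseq_Ioo_left(2)[of x "x + h", symmetric]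
    by (rule SUP_emeasure_incseq[symmetric]) (force, rule incseq_Ioo_left(1))
  with h obtain n where n: "ennreal t * ennreal h < ?m {x + inverse (real (Suc n))<..<x + h}"
    by (auto simp: less_SUP_iff)
  define \<delta> where "\<delta> = inverse (real (Suc n))"
  have "0 < \<delta>" by (simp add: \<delta>_def)
  have "\<exists>\<eta>>0. ennreal t * ennreal (h + \<eta>) < ?m {x + \<delta><..<x + h}"
  proof (cases "t \<le> 0")
    case True
    then have "ennreal t = 0" by (simp add: ennreal_neg)
    with n show ?thesis by (auto simp: \<delta>_def intro!: exI[of _ 1])
  next
    case False
    obtain z where z: "ennreal t * ennreal h < z" "z < ?m {x + \<delta><..<x + h}"
      using n dense unfolding \<delta>_def by blast
    then obtain r where r: "z = ennreal r" "0 \<le> r"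
      by (cases z rule: ennreal_cases) auto
    have "t * h < r"
      using z(1) False h(1) by (auto simp: r ennreal_less_iff simp flip: ennreal_mult)
    define \<eta> where "\<eta> = r / t - h"
    have "0 < \<eta>" "t * (h + \<eta>) = r" using \<open>t * h < r\<close> False by (auto simp: \<eta>_def field_simps)
    then show ?thesis using z(2) False h(1) r
      by (intro exI[of _ \<eta>]) (simp flip: ennreal_mult ennreal_plus)
  qed
  then obtain \<eta> where \<eta>: "0 < \<eta>" "ennreal t * ennreal (h + \<eta>) < ?m {x + \<delta><..<x + h}" by blast
  have "{x + \<delta><..<x + h} \<noteq> {}" using n by (auto simp: \<delta>_def)
  then have "\<delta> < h" by auto
  show "\<exists>e>0. ball x e \<subseteq> {x. ennreal t < maximal_plus g x}"
  proof (intro exI conjI subsetI)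
    show "0 < min \<delta> \<eta>" using \<open>0 < \<delta>\<close> \<open>0 < \<eta>\<close> by simp
    fix z assume "z \<in> ball x (min \<delta> \<eta>)"
    then have z: "x - \<eta> < z" "z < x + \<delta>" by (auto simp: dist_real_def)
    have "ennreal t * ennreal (x + h - z) \<le> ennreal t * ennreal (h + \<eta>)"
      using z by (intro mult_left_mono ennreal_leI) auto
    also have "\<dots> < ?m {x + \<delta><..<x + h}" by fact
    also have "\<dots> \<le> ?m {z<..<x + h}" using z by (intro emeasure_mono) auto
    finally have "ennreal t * ennreal (x + h - z) < ?m {z<..<z + (x + h - z)}" by simp
    moreover have "0 < x + h - z" using z \<open>\<delta> < h\<close> by simp
    ultimately show "z \<in> {x. ennreal t < maximal_plus g x}"
      unfolding mem_Collect_eq maximal_plus_gt_iff[OF g] by blast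
  qed
qed

lemma open_superlevel_measurable:
  fixes u :: "real \<Rightarrow> ennreal"
  assumes "\<And>t. 0 \<le> t \<Longrightarrow> open {x. ennreal t < u x}"
  shows "u \<in> borel_measurable borel"
proof (rule borel_measurableI_greater)
  fix y :: ennreal
  have "{x. y < u x} \<in> sets borel"
  proof (cases y rule: ennreal_cases)
    case (real r)
    then show ?thesis using assms[of r] by auto
  qed simp
  then show "{x \<in> space borel. y < u x} \<in> sets borel" by simp
qed

lemma maximal_plus_measurable:
  assumes "g \<in> borel_measurable lebesgue"
  shows "maximal_plus g \<in> borel_measurable borel"
  using open_superlevel_measurable open_maximal_plus_gt[OF assms] by blast

text \<open>
  The interval of a one-sided average does not contain its base point, so the covering
  inequality does not apply to it directly. As the inequality is strict, there is room to move the
  left endpoint below \<open>x\<close>.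
\<close>

lemma maximal_plus_gt_interval:
  assumes g: "g \<in> borel_measurable lebesgue" and gt: "ennreal t < maximal_plus g x" and "c < x" "0 \<le> t"
  obtains a b where "c < a" "a < x" "x < b"
    "ennreal (t * (b - a)) \<le> emeasure (integral_measure g) {a<..<b}"
proof -
  let ?m = "emeasure (integral_measure g)"
  obtain h where h: "0 < h" "ennreal t * ennreal h < ?m {x<..<x + h}"
    using g gt by (auto simp: maximal_plus_gt_iff)
  obtain z where z: "ennreal t * ennreal h < z" "z < ?m {x<..<x + h}"
    using h(2) dense by blast
  then obtain r where r: "z = ennreal r" "0 \<le> r"
    by (cases z rule: ennreal_cases) auto
  have "t * h < r"
    using z(1) \<open>0 \<le> t\<close> h(1) by (auto simp: r ennreal_less_iff simp flip: ennreal_mult)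
  \<comment> \<open>Lengthening the interval by \<open>\<eta>\<close> costs \<open>t \<eta> \<le> r - t h\<close>; the denominator \<open>t + 1\<close> allows \<open>t = 0\<close>.\<close>
  define \<eta> where "\<eta> = min ((r - t * h) / (t + 1)) ((x - c) / 2)"
  have \<eta>: "0 < \<eta>" "\<eta> < x - c" using \<open>t * h < r\<close> \<open>c < x\<close> \<open>0 \<le> t\<close> by (auto simp: \<eta>_def min_less_iff_disj)
  have "t * \<eta> \<le> (t + 1) * ((r - t * h) / (t + 1))" 
    using \<eta> \<open>0 \<le> t\<close> \<open>t * h < r\<close> by (intro mult_mono) (auto simp: \<eta>_def)
  also have "\<dots> = r - t * h" using \<open>0 \<le> t\<close> by simp
  finally have le: "t * (x + h - (x - \<eta>)) \<le> r" by (simp add: algebra_simps)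
  have "ennreal (t * (x + h - (x - \<eta>))) \<le> ennreal r" by (intro ennreal_leI le)
  also have "\<dots> \<le> ?m {x<..<x + h}" using z(2) r by simp
  also have "\<dots> \<le> ?m {x - \<eta><..<x + h}" using \<eta> by (intro emeasure_mono) auto
  finally show ?thesis using that[of "x - \<eta>" "x + h"] \<eta> h(1) by simp
qed

text \<open>
  The weak type (1,1) bound \<open>n |{M\<^sup>+ g = \<infinity>}| \<le> 2 \<parallel>g\<parallel>\<^sub>1\<close> for every \<open>n\<close>.
\<close>

lemma AE_maximal_plus_finite:
  assumes g: "g \<in> borel_measurable lebesgue" and fin: "emeasure (integral_measure g) UNIV < top"
  shows "AE x in lebesgue. maximal_plus g x < top"
proof -
  let ?m = "emeasure (integral_measure g)"
  define N where "N = {x. maximal_plus g x = top}"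
  have N: "N \<in> sets borel"
    using maximal_plus_measurable[OF g] unfolding N_def by measurable
  have bound: "ennreal n * emeasure lebesgue N \<le> 2 * ?m UNIV" if "0 < n" for n
  proof -
    define F where "F = {(a, b). a < b \<and> ennreal (n * (b - a)) \<le> ?m {a<..<b}}"
    have \<mu>: "emeasure (integral_measure (\<lambda>_. n)) A = ennreal n
        * emeasure lebesgue A" if "A \<in> sets lebesgue" for A
      using that \<open>0 < n\<close> by (simp add: emeasure_integral_measure nn_integral_cmult_indicator)
    have op: "open (\<Union>(a, b)\<in>F. {a<..<b})" by (intro open_UN ballI) (simp add: case_prod_beta)
    have "N \<subseteq> (\<Union>(a, b)\<in>F. {a<..<b})"
    proof
      fix z assume "z \<in> N"
      then have "ennreal n < maximal_plus g z" by (simp add: N_def)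
      then obtain a b where ab: "a < z" "z < b" "ennreal (n * (b - a)) \<le> ?m {a<..<b}"
        using \<open>0 < n\<close> by (elim maximal_plus_gt_interval[OF g, of n z "z - 1"]) auto
      then have "(a, b) \<in> F" by (simp add: F_def)
      then show "z \<in> (\<Union>(a, b)\<in>F. {a<..<b})" using ab by (intro UN_I[of "(a, b)"]) simp_all
    qed
    then have "ennreal n * emeasure lebesgue N \<le> ennreal n * emeasure lebesgue (\<Union>(a, b)\<in>F. {a<..<b})"
      using op by (intro mult_left_mono emeasure_mono) auto
    also have "\<dots> = emeasure (integral_measure (\<lambda>_. n)) (\<Union>(a, b)\<in>F. {a<..<b})"
      using op by (subst \<mu>) auto
    also have "\<dots> \<le> 2 * ?m UNIV"
    proof (rule emeasure_Union_Ioo_le)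
      fix a b assume "(a, b) \<in> F"
      then show "emeasure (integral_measure (\<lambda>_. n)) {a<..<b} \<le> ?m {a<..<b}"
        using \<open>0 < n\<close> by (simp add: F_def \<mu> flip: ennreal_mult)
    qed simp_all
    finally show ?thesis .
  qed
  have "emeasure lebesgue N = 0"
  proof (rule ccontr)
    assume "emeasure lebesgue N \<noteq> 0"
    obtain c where c: "2 * ?m UNIV = ennreal c" "0 \<le> c"
      using fin by (cases "2 * ?m UNIV" rule: ennreal_cases) (auto simp: ennreal_mult_eq_top_iff)
    have "emeasure lebesgue N \<noteq> top"
      using bound[of 1] c by (auto simp: top_unique)
    then obtain d where d: "emeasure lebesgue N = ennreal d" "0 < d"
      using \<open>emeasure lebesgue N \<noteq> 0\<close> by (cases "emeasure lebesgue N" rule: ennreal_cases) auto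
    have "0 < (c + 1) / d" using c d by (simp add: add_nonneg_pos)
    from bound[OF this] show False using c d
      by (simp add: ennreal_le_iff flip: ennreal_mult)
  qed
  then have "N \<in> null_sets lebesgue" using N by (simp add: null_sets_def)
  then have "AE x in lebesgue. x \<notin> N" by (rule AE_not_in)
  then show ?thesis by eventually_elim (auto simp: N_def top.not_eq_extremum)
qed

text \<open>
  A localised weak type bound. The bound at \<open>x\<close> keeps the intervals that witness a large value
  at \<open>z\<close> short: their average is above \<open>8 s\<close>, but together with the gap from \<open>x\<close> they have average
  at most \<open>s\<close>. So only the mass of \<open>(x, x + 2 r)\<close>, which is at most \<open>2 r s\<close>, matters.
\<close>

lemma maximal_plus_superlevel_local:
  assumes g: "g \<in> borel_measurable lebesgue" and "0 < s" "0 < r"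
    and le: "maximal_plus g x \<le> ennreal s"
  shows "emeasure lebesgue ({x<..<x + r} \<inter> {z. ennreal (8 * s) < maximal_plus g z}) \<le> ennreal (r / 2)"
proof -
  let ?m = "emeasure (integral_measure g)"
  define F where "F = {(a, b). x < a \<and> a < b \<and> b \<le> x + 2 * r \<and> ennreal (8 * s * (b - a)) \<le> ?m {a<..<b}}"
  define \<mu> where "\<mu> = integral_measure (\<lambda>_. 8 * s)"
  define \<nu> where "\<nu> = integral_measure (\<lambda>y. g y * indicator {x<..<x + 2 * r} y)"
  have \<mu>: "emeasure \<mu> A = ennreal (8 * s) * emeasure lebesgue A" if "A \<in> sets lebesgue" for A
    using that \<open>0 < s\<close> by (simp add: \<mu>_def emeasure_integral_measure nn_integral_cmult_indicator)
  have \<nu>: "emeasure \<nu> A = ?m (A \<inter> {x<..<x + 2 * r})" if "A \<in> sets lebesgue" for A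
    unfolding \<nu>_def using g that by (intro emeasure_integral_measure_restrict) auto
  have sub: "{x<..<x + r} \<inter> {z. ennreal (8 * s) < maximal_plus g z} \<subseteq> (\<Union>(a, b)\<in>F. {a<..<b})"
  proof
    fix z assume "z \<in> {x<..<x + r} \<inter> {z. ennreal (8 * s) < maximal_plus g z}"
    then have z: "x < z" "z < x + r" "ennreal (8 * s) < maximal_plus g z" by auto
    obtain a b where ab: "x < a" "a < z" "z < b" "ennreal (8 * s * (b - a)) \<le> ?m {a<..<b}"
      using maximal_plus_gt_interval[OF g z(3) z(1)] \<open>0 < s\<close> by auto
    note ab(4)
    also have "?m {a<..<b} \<le> ?m {x<..<x + (b - x)}"
      using ab by (intro emeasure_mono) auto
    also have "\<dots> \<le> maximal_plus g x * ennreal (b - x)"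
      using ab by (intro maximal_plus_ge[OF g]) simp
    also have "\<dots> \<le> ennreal s * ennreal (b - x)" by (intro mult_right_mono le) simp
    also have "\<dots> = ennreal (s * (b - x))" using ab \<open>0 < s\<close> by (simp add: ennreal_mult)
    finally have "s * (8 * (b - a)) \<le> s * (b - x)"
      using ab \<open>0 < s\<close> by (simp add: ennreal_le_iff)
    then have "8 * (b - a) \<le> b - x" using \<open>0 < s\<close> by (simp only: mult_le_cancel_left_pos)
    then have "(a, b) \<in> F" using ab z by (simp add: F_def)
    then show "z \<in> (\<Union>(a, b)\<in>F. {a<..<b})" using ab by (intro UN_I[of "(a, b)"]) simp_all
  qed
  have op: "open (\<Union>(a, b)\<in>F. {a<..<b})" by (intro open_UN ballI) (simp add: case_prod_beta)
  have "ennreal (8 * s) * emeasure lebesgue (\<Union>(a, b)\<in>F. {a<..<b}) = emeasure \<mu> (\<Union>(a, b)\<in>F. {a<..<b})"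
    using op by (subst \<mu>) auto
  also have "\<dots> \<le> 2 * emeasure \<nu> UNIV"
  proof (rule emeasure_Union_Ioo_le)
    fix a b assume "(a, b) \<in> F"
    then have ab: "x < a" "a < b" "b \<le> x + 2 * r" "ennreal (8 * s * (b - a)) \<le> ?m {a<..<b}"
      by (auto simp: F_def)
    have "emeasure \<mu> {a<..<b} = ennreal (8 * s * (b - a))"
      using ab \<open>0 < s\<close> by (simp add: \<mu> ennreal_mult)
    also have "\<dots> \<le> ?m {a<..<b}" by fact
    also have "\<dots> = emeasure \<nu> {a<..<b}"
    proof -
      have "{a<..<b} \<inter> {x<..<x + 2 * r} = {a<..<b}" using ab by auto
      then show ?thesis using \<nu>[OF Ioo_lebesgue] by metis
    qed
    finally show "emeasure \<mu> {a<..<b} \<le> emeasure \<nu> {a<..<b}" .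
  qed (simp_all add: \<mu>_def \<nu>_def)
  also have "emeasure \<nu> UNIV = ?m {x<..<x + 2 * r}" by (simp add: \<nu>)
  also have "\<dots> \<le> maximal_plus g x * ennreal (2 * r)"
    using \<open>0 < r\<close> by (intro maximal_plus_ge[OF g]) simp
  also have "\<dots> \<le> ennreal s * ennreal (2 * r)" by (intro mult_right_mono le) simp
  finally have "ennreal (8 * s) * emeasure lebesgue (\<Union>(a, b)\<in>F. {a<..<b}) \<le> 2 * (ennreal s * ennreal (2 * r))"
    by (simp add: mult_left_mono)
  also have "\<dots> = ennreal (8 * s) * ennreal (r / 2)"
    using \<open>0 < s\<close> \<open>0 < r\<close> by (simp flip: ennreal_mult ennreal_numeral)
  finally have "emeasure lebesgue (\<Union>(a, b)\<in>F. {a<..<b}) \<le> ennreal (r / 2)"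
    using \<open>0 < s\<close> by (subst (asm) ennreal_mult_le_mult_iff) auto
  moreover have "emeasure lebesgue ({x<..<x + r} \<inter> {z. ennreal (8 * s) < maximal_plus g z})
      \<le> emeasure lebesgue (\<Union>(a, b)\<in>F. {a<..<b})"
    using sub op by (intro emeasure_mono) auto
  ultimately show ?thesis by (rule order_trans[rotated])
qed

section \<open>Young functions and Luxemburg averages\<close>

lemma young_function_nonneg: "young_function \<Phi> \<Longrightarrow> 0 \<le> t \<Longrightarrow> 0 \<le> \<Phi> t"
  by (simp add: young_function_def)

lemma young_function_scale:
  assumes "young_function \<Phi>" and "0 \<le> t" and "0 \<le> u" "u \<le> 1"
  shows "\<Phi> (u * t) \<le> u * \<Phi> t"
proof -
  have "convex_on {0..} \<Phi>" "\<Phi> 0 = 0" using assms(1) by (auto simp: young_function_def)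
  then show ?thesis
    using convex_onD[of "{0..}" \<Phi> u 0 t] assms(2-4) by simp
qed

lemma young_function_mono:
  assumes \<Phi>: "young_function \<Phi>" and "0 \<le> s" "s \<le> t"
  shows "\<Phi> s \<le> \<Phi> t"
proof (cases "t = 0")
  case False
  then have "0 < t" using assms by simp
  have "\<Phi> s \<le> (s / t) * \<Phi> t"
    using young_function_scale[OF \<Phi>, of t "s / t"] assms \<open>0 < t\<close> by simp
  also have "\<dots> \<le> 1 * \<Phi> t"
    using assms \<open>0 < t\<close> young_function_nonneg[OF \<Phi>, of t] by (intro mult_right_mono) auto
  finally show ?thesis by simp
qed (use assms in auto)

lemma young_function_linear_growth:
  assumes \<Phi>: "young_function \<Phi>" and s: "0 < s" "0 < \<Phi> s" and "0 \<le> t"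
  shows "t \<le> s * (1 + \<Phi> t / \<Phi> s)"
proof (cases "t \<le> s")
  case True
  have "t \<le> s * 1" using True by simp
  also have "\<dots> \<le> s * (1 + \<Phi> t / \<Phi> s)"
    using s young_function_nonneg[OF \<Phi> \<open>0 \<le> t\<close>] by (intro mult_left_mono) auto
  finally show ?thesis .
next
  case False
  then have "\<Phi> s \<le> (s / t) * \<Phi> t"
    using young_function_scale[OF \<Phi>, of t "s / t"] s by simp
  then have "t \<le> s * (\<Phi> t / \<Phi> s)" using False s by (simp add: field_simps)
  also have "\<dots> \<le> s * (1 + \<Phi> t / \<Phi> s)" using s by (simp add: algebra_simps)
  finally show ?thesis .
qed

lemma young_function_measurable:
  assumes \<Phi>: "young_function \<Phi>" and [measurable]: "f \<in> borel_measurable M"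
    and "0 < l"
  shows "(\<lambda>x. \<Phi> (\<bar>f x\<bar> / l)) \<in> borel_measurable M"
proof -
  have "continuous_on UNIV (\<lambda>x. \<Phi> (max 0 x))"
  proof -
    have "continuous_on {0..} \<Phi>" using \<Phi> by (simp add: young_function_def)
    moreover have "continuous_on UNIV (\<lambda>x :: real. max 0 x)" by (intro continuous_intros)
    ultimately show ?thesis by (rule continuous_on_compose2) auto
  qed
  then have [measurable]: "(\<lambda>x. \<Phi> (max 0 x)) \<in> borel_measurable borel"
    by (rule borel_measurable_continuous_onI)
  have "(\<lambda>x. \<Phi> (max 0 (\<bar>f x\<bar> / l))) \<in> borel_measurable M" by measurable
  then show ?thesis using \<open>0 < l\<close> by (simp add: max_def)
qed

lemma gen_inverse_ge:
  assumes "young_function \<Phi>" and "0 \<le> u" and "\<Phi> u \<le> t"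
  shows "ennreal u \<le> gen_inverse \<Phi> t"
  unfolding gen_inverse_def
proof (rule INF_greatest)
  fix s assume "s \<in> {s. 0 \<le> s \<and> t < \<Phi> s}"
  then have "\<not> s \<le> u" using young_function_mono[OF assms(1), of s u] assms(3) by auto
  then show "ennreal u \<le> ennreal s" by (simp add: ennreal_leI)
qed

text \<open>
  A Young inequality: with \<open>t\<close> above both \<open>\<Phi> u\<close> and \<open>\<Psi> v\<close>, the numbers \<open>u\<close> and \<open>v\<close> are bounded by
  the inverses at \<open>t\<close>. The summand \<open>e / \<kappa>\<close> makes \<open>t\<close> positive.
\<close>

lemma young_product_le:
  assumes \<Phi>: "young_function \<Phi>" and \<Psi>: "young_function \<Psi>" and "0 < \<kappa>"
    and inv: "\<And>t. 0 < t \<Longrightarrow> gen_inverse \<Phi> t * gen_inverse \<Psi> t \<le> ennreal (\<kappa> * t)"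
    and "0 \<le> u" "0 \<le> v"
  shows "u * v \<le> \<kappa> * (\<Phi> u + \<Psi> v)"
proof (rule field_le_epsilon)
  fix e :: real assume "0 < e"
  define t where "t = \<Phi> u + \<Psi> v + e / \<kappa>"
  have nn: "0 \<le> \<Phi> u" "0 \<le> \<Psi> v"
    using assms young_function_nonneg by blast+
  then have t: "0 < t" "\<Phi> u \<le> t" "\<Psi> v \<le> t"
    using \<open>0 < e\<close> \<open>0 < \<kappa>\<close> by (auto simp: t_def add_nonneg_pos)
  have "ennreal (u * v) = ennreal u * ennreal v" using assms by (simp add: ennreal_mult)
  also have "\<dots> \<le> gen_inverse \<Phi> t * gen_inverse \<Psi> t"
    using t assms by (intro mult_mono gen_inverse_ge) auto
  also have "\<dots> \<le> ennreal (\<kappa> * t)" by (rule inv) fact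
  finally have "u * v \<le> \<kappa> * t" using t \<open>0 < \<kappa>\<close> by (simp add: ennreal_le_iff)
  then show "u * v \<le> \<kappa> * (\<Phi> u + \<Psi> v) + e"
    using \<open>0 < \<kappa>\<close> by (simp add: t_def distrib_left)
qed

text \<open>
  The hypothesis on the inverses excludes \<open>\<Phi> = 0\<close>, since \<open>u\<close> can be arbitrarily large for fixed \<open>v\<close>.
\<close>

lemma young_product_imp_pos:
  assumes "young_function \<Phi>" and "0 < \<kappa>"
    and prod: "\<And>u v. 0 \<le> u \<Longrightarrow> 0 \<le> v \<Longrightarrow> u * v \<le> \<kappa> * (\<Phi> u + \<Psi> v)"
  obtains s where "0 < s" "0 < \<Phi> s"
proof -
  define s where "s = \<kappa> * \<bar>\<Psi> 1\<bar> + 1"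
  have "0 < s" using \<open>0 < \<kappa>\<close> by (simp add: s_def add_nonneg_pos)
  have "s * 1 \<le> \<kappa> * (\<Phi> s + \<Psi> 1)" using \<open>0 < s\<close> by (intro prod) auto
  also have "\<dots> \<le> \<kappa> * \<Phi> s + \<kappa> * \<bar>\<Psi> 1\<bar>"
    using \<open>0 < \<kappa>\<close> by (simp add: distrib_left)
  finally have "0 < \<kappa> * \<Phi> s" by (simp add: s_def)
  then have "0 < \<Phi> s" using \<open>0 < \<kappa>\<close> by (simp add: zero_less_mult_iff)
  with \<open>0 < s\<close> show ?thesis by (rule that)
qed

lemma luxemburg_Ioo:
  assumes "a < c"
  shows "luxemburg \<Phi> f {a<..<c} =
    (INF l\<in>{l. 0 < l \<and> (\<integral>\<^sup>+x\<in>{a<..<c}. ennreal (\<Phi> (\<bar>f x\<bar> / l)) \<partial>lebesgue) \<le> ennreal (c - a)}. ennreal l)"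
proof -
  have "x / ennreal (c - a) \<le> 1 \<longleftrightarrow> x \<le> ennreal (c - a)" for x
    using ennreal_less_divide_iff[of "c - a" 1 x] assms by (simp add: not_less[symmetric])
  then show ?thesis using assms by (simp add: luxemburg_def)
qed

lemma nn_integral_le_luxemburg:
  assumes \<Phi>: "young_function \<Phi>" and s: "0 < s" "0 < \<Phi> s"
    and [measurable]: "f \<in> borel_measurable lebesgue" and "a < c"
  shows "(\<integral>\<^sup>+x\<in>{a<..<c}. ennreal \<bar>f x\<bar> \<partial>lebesgue)
    \<le> ennreal (s * (1 + 1 / \<Phi> s) * (c - a)) * luxemburg \<Phi> f {a<..<c}"
  unfolding luxemburg_Ioo[OF \<open>a < c\<close>]
proof (rule ennreal_le_mult_INF)
  have "0 < s * (1 + 1 / \<Phi> s) * (c - a)" using s \<open>a < c\<close> by (simp add: add_pos_pos)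
  then show "ennreal (s * (1 + 1 / \<Phi> s) * (c - a)) \<noteq> 0"
    by (simp only: ennreal_eq_0_iff not_le)
  fix l assume "l \<in> {l. 0 < l \<and> (\<integral>\<^sup>+x\<in>{a<..<c}. ennreal (\<Phi> (\<bar>f x\<bar> / l)) \<partial>lebesgue) \<le> ennreal (c - a)}"
  then have l: "0 < l" "(\<integral>\<^sup>+x\<in>{a<..<c}. ennreal (\<Phi> (\<bar>f x\<bar> / l)) \<partial>lebesgue) \<le> ennreal (c - a)"
    by auto
  note [measurable] = young_function_measurable[OF \<Phi> _ l(1)]
  have pt: "ennreal \<bar>f x\<bar> \<le> ennreal (l * s) + ennreal (l * s / \<Phi> s) * ennreal (\<Phi> (\<bar>f x\<bar> / l))" for x
  proof -
    have nn: "0 \<le> \<Phi> (\<bar>f x\<bar> / l)" using young_function_nonneg[OF \<Phi>] l(1) by simp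
    have "\<bar>f x\<bar> / l \<le> s * (1 + \<Phi> (\<bar>f x\<bar> / l) / \<Phi> s)"
      using young_function_linear_growth[OF \<Phi> s, of "\<bar>f x\<bar> / l"] l(1) by simp
    then have "\<bar>f x\<bar> \<le> l * s + l * s / \<Phi> s * \<Phi> (\<bar>f x\<bar> / l)"
      using l(1) s by (simp add: field_simps)
    then show ?thesis using l(1) s nn by (simp flip: ennreal_mult ennreal_plus)
  qed
  have "(\<integral>\<^sup>+x\<in>{a<..<c}. ennreal \<bar>f x\<bar> \<partial>lebesgue)
      \<le> (\<integral>\<^sup>+x. ennreal (l * s) * indicator {a<..<c} x
            + ennreal (l * s / \<Phi> s) * (ennreal (\<Phi> (\<bar>f x\<bar> / l)) * indicator {a<..<c} x) \<partial>lebesgue)"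
    using pt by (intro nn_integral_mono) (simp add: indicator_def)
  also have "\<dots> = ennreal (l * s) * ennreal (c - a)
      + ennreal (l * s / \<Phi> s) * (\<integral>\<^sup>+x\<in>{a<..<c}. ennreal (\<Phi> (\<bar>f x\<bar> / l)) \<partial>lebesgue)"
    using \<open>a < c\<close> by (simp add: nn_integral_add nn_integral_cmult)
  also have "\<dots> \<le> ennreal (l * s) * ennreal (c - a) + ennreal (l * s / \<Phi> s) * ennreal (c - a)"
    by (intro add_left_mono mult_left_mono l(2)) simp
  also have "\<dots> = ennreal (s * (1 + 1 / \<Phi> s) * (c - a)) * ennreal l"
  proof -
    have "l * s * (c - a) + l * s / \<Phi> s * (c - a) = s * (1 + 1 / \<Phi> s) * (c - a) * l"
      by (simp add: algebra_simps add_divide_distrib diff_divide_distrib)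
    moreover have "0 \<le> 1 + 1 / \<Phi> s" "0 \<le> c - a" using s \<open>a < c\<close> by auto
    ultimately show ?thesis using l(1) s by (simp flip: ennreal_mult ennreal_plus)
  qed
  finally show "(\<integral>\<^sup>+x\<in>{a<..<c}. ennreal \<bar>f x\<bar> \<partial>lebesgue)
    \<le> ennreal (s * (1 + 1 / \<Phi> s) * (c - a)) * ennreal l" .
qed simp

lemma luxemburg_eq_0_imp:
  assumes \<Phi>: "young_function \<Phi>" and s: "0 < s" "0 < \<Phi> s"
    and [measurable]: "f \<in> borel_measurable lebesgue" and "a < c"
    and "luxemburg \<Phi> f {a<..<c} = 0"
  shows "AE x in lebesgue. x \<in> {a<..<c} \<longrightarrow> f x = 0"
proof -
  have "(\<integral>\<^sup>+x. ennreal \<bar>f x\<bar> * indicator {a<..<c} x \<partial>lebesgue) = 0"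
    using nn_integral_le_luxemburg[OF \<Phi> s assms(4) \<open>a < c\<close>] assms(6) by simp
  then have "AE x in lebesgue. ennreal \<bar>f x\<bar> * indicator {a<..<c} x = 0"
    by (simp add: nn_integral_0_iff_AE)
  then show ?thesis by eventually_elim (auto simp: indicator_def split: if_splits)
qed

text \<open>
  Apply the Young inequality to \<open>|f| / l\<close> and \<open>|g| / m\<close> for admissible \<open>l\<close> and \<open>m\<close>, integrate, and take
  infima. If one average is 0 and the other infinite, the right-hand side is 0, and the bound
  holds because the integrand vanishes almost everywhere.
\<close>

lemma luxemburg_Holder:
  assumes \<Phi>: "young_function \<Phi>" and \<Psi>: "young_function \<Psi>" and "0 < \<kappa>"
    and prod: "\<And>u v. 0 \<le> u \<Longrightarrow> 0 \<le> v \<Longrightarrow> u * v \<le> \<kappa> * (\<Phi> u + \<Psi> v)"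
    and [measurable]: "f \<in> borel_measurable lebesgue" "g \<in> borel_measurable lebesgue" and "a < c"
  shows "(\<integral>\<^sup>+x\<in>{a<..<c}. ennreal \<bar>f x * g x\<bar> \<partial>lebesgue)
    \<le> ennreal (2 * \<kappa> * (c - a)) * (luxemburg \<Phi> f {a<..<c} * luxemburg \<Psi> g {a<..<c})"
proof -
  let ?X = "\<integral>\<^sup>+x\<in>{a<..<c}. ennreal \<bar>f x * g x\<bar> \<partial>lebesgue"
  let ?K = "ennreal (2 * \<kappa> * (c - a))"
  have "0 < 2 * \<kappa> * (c - a)" using \<open>0 < \<kappa>\<close> \<open>a < c\<close> by simp
  then have K: "?K \<noteq> 0" "?K \<noteq> top" by (simp_all only: ennreal_eq_0_iff not_le ennreal_neq_top not_False_eq_True)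
  let ?A = "\<lambda>\<Phi> f. {l. 0 < l \<and> (\<integral>\<^sup>+x\<in>{a<..<c}. ennreal (\<Phi> (\<bar>f x\<bar> / l)) \<partial>lebesgue) \<le> ennreal (c - a)}"
  have zero: "?X = 0" if "AE x in lebesgue. x \<in> {a<..<c} \<longrightarrow> f x * g x = 0"
  proof -
    have "AE x in lebesgue. ennreal \<bar>f x * g x\<bar> * indicator {a<..<c} x = 0"
      using that by eventually_elim (auto simp: indicator_def)
    then show ?thesis by (simp add: nn_integral_0_iff_AE)
  qed
  consider "luxemburg \<Phi> f {a<..<c} = 0" | "luxemburg \<Psi> g {a<..<c} = 0"
    | "luxemburg \<Phi> f {a<..<c} \<noteq> 0" "luxemburg \<Psi> g {a<..<c} \<noteq> 0" "luxemburg \<Phi> f {a<..<c} = top"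
    | "luxemburg \<Phi> f {a<..<c} \<noteq> 0" "luxemburg \<Phi> f {a<..<c} \<noteq> top" by blast
  then show ?thesis
  proof cases
    case 1
    obtain s where "0 < s" "0 < \<Phi> s" using young_product_imp_pos[OF \<Phi> \<open>0 < \<kappa>\<close> prod] .
    from luxemburg_eq_0_imp[OF \<Phi> this _ \<open>a < c\<close> 1] have "?X = 0"
      by (intro zero) auto
    then show ?thesis by simp
  next
    case 2
    have "u * v \<le> \<kappa> * (\<Psi> u + \<Phi> v)" if "0 \<le> u" "0 \<le> v" for u v
      using prod[OF that(2,1)] by (simp add: algebra_simps)
    then obtain s where "0 < s" "0 < \<Psi> s" using young_product_imp_pos[OF \<Psi> \<open>0 < \<kappa>\<close>] by blast
    from luxemburg_eq_0_imp[OF \<Psi> this _ \<open>a < c\<close> 2] have "?X = 0"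
      by (intro zero) auto
    then show ?thesis by simp
  next
    case 3
    then show ?thesis using K by (simp add: ennreal_mult_top ennreal_top_mult)
  next
    case 4
    have both: "?X \<le> ?K * ennreal l * ennreal m" if l: "l \<in> ?A \<Phi> f" and m: "m \<in> ?A \<Psi> g" for l m
    proof -
      have [simp]: "0 < l" "0 < m" using l m by auto
      note [measurable] = young_function_measurable[OF \<Phi> _ \<open>0 < l\<close>] young_function_measurable[OF \<Psi> _ \<open>0 < m\<close>]
      let ?k = "ennreal (\<kappa> * l * m)"
      have pt: "ennreal \<bar>f x * g x\<bar> \<le> ?k * (ennreal (\<Phi> (\<bar>f x\<bar> / l)) + ennreal (\<Psi> (\<bar>g x\<bar> / m)))" for x
      proof -
        have nn: "0 \<le> \<Phi> (\<bar>f x\<bar> / l)" "0 \<le> \<Psi> (\<bar>g x\<bar> / m)"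
          using young_function_nonneg[OF \<Phi>] young_function_nonneg[OF \<Psi>] by (simp_all add: less_imp_le)
        have "(\<bar>f x\<bar> / l) * (\<bar>g x\<bar> / m) \<le> \<kappa> * (\<Phi> (\<bar>f x\<bar> / l) + \<Psi> (\<bar>g x\<bar> / m))"
          by (intro prod) (simp_all add: less_imp_le)
        then have "\<bar>f x * g x\<bar> \<le> (\<kappa> * l * m) * (\<Phi> (\<bar>f x\<bar> / l) + \<Psi> (\<bar>g x\<bar> / m))"
          by (simp add: abs_mult divide_le_eq mult_ac)
        then show ?thesis using nn \<open>0 < \<kappa>\<close>
          by (simp add: less_imp_le flip: ennreal_mult ennreal_plus)
      qed
      have "?X \<le> (\<integral>\<^sup>+x. ?k * (ennreal (\<Phi> (\<bar>f x\<bar> / l)) * indicator {a<..<c} x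
          + ennreal (\<Psi> (\<bar>g x\<bar> / m)) * indicator {a<..<c} x) \<partial>lebesgue)"
        using pt by (intro nn_integral_mono) (auto simp: indicator_def)
      also have "\<dots> = ?k * ((\<integral>\<^sup>+x\<in>{a<..<c}. ennreal (\<Phi> (\<bar>f x\<bar> / l)) \<partial>lebesgue)
          + (\<integral>\<^sup>+x\<in>{a<..<c}. ennreal (\<Psi> (\<bar>g x\<bar> / m)) \<partial>lebesgue))"
        by (simp add: nn_integral_add nn_integral_cmult)
      also have "\<dots> \<le> ?k * (ennreal (c - a) + ennreal (c - a))"
        using l m by (intro mult_left_mono add_mono) auto
      also have "\<dots> = ?K * ennreal l * ennreal m"
      proof -
        have "\<kappa> * l * m * ((c - a) + (c - a)) = 2 * \<kappa> * (c - a) * l * m"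
          by (simp add: algebra_simps)
        moreover have "0 \<le> c - a" "0 \<le> \<kappa>" "0 \<le> l" "0 \<le> m"
          using \<open>0 < \<kappa>\<close> \<open>a < c\<close> \<open>0 < l\<close> \<open>0 < m\<close> by linarith+
        ultimately show ?thesis by (simp only: mult_nonneg_nonneg add_nonneg_nonneg
              zero_le_numeral flip: ennreal_mult ennreal_plus)
      qed
      finally show ?thesis .
    qed
    have "?X \<le> ?K * luxemburg \<Phi> f {a<..<c} * ennreal m" if m: "m \<in> ?A \<Psi> g" for m
    proof -
      have "?X \<le> (?K * ennreal m) * luxemburg \<Phi> f {a<..<c}"
        unfolding luxemburg_Ioo[OF \<open>a < c\<close>, of \<Phi>]
        using both m K by (intro ennreal_le_mult_INF) (auto simp: ennreal_mult_eq_top_iff mult_ac)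
      then show ?thesis by (simp add: mult_ac)
    qed
    then have "?X \<le> (?K * luxemburg \<Phi> f {a<..<c}) * luxemburg \<Psi> g {a<..<c}"
      unfolding luxemburg_Ioo[OF \<open>a < c\<close>, of \<Psi>]
      using 4 K by (intro ennreal_le_mult_INF) (auto simp: ennreal_mult_eq_top_iff)
    then show ?thesis by (simp add: mult_ac)
  qed
qed

text \<open>
  Shrinking the interval while keeping the support inside can only increase the average, since
  \<open>\<Phi> 0 = 0\<close> and the length decreases.
\<close>

lemma luxemburg_le_shrink:
  assumes \<Phi>: "young_function \<Phi>" and "a \<le> z" "z < c"
    and le: "\<And>x. z < x \<Longrightarrow> x < c \<Longrightarrow> \<bar>f x\<bar> \<le> \<bar>g x\<bar>"
    and zero: "\<And>x. a < x \<Longrightarrow> x \<le> z \<Longrightarrow> f x = 0"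
  shows "luxemburg \<Phi> f {a<..<c} \<le> luxemburg \<Phi> g {z<..<c}"
proof -
  have "a < c" using assms by simp
  have "(\<integral>\<^sup>+x\<in>{a<..<c}. ennreal (\<Phi> (\<bar>f x\<bar> / l)) \<partial>lebesgue) \<le> ennreal (c - a)"
    if l: "0 < l" and int: "(\<integral>\<^sup>+x\<in>{z<..<c}. ennreal (\<Phi> (\<bar>g x\<bar> / l)) \<partial>lebesgue) \<le> ennreal (c - z)" for l
  proof -
    have "(\<integral>\<^sup>+x\<in>{a<..<c}. ennreal (\<Phi> (\<bar>f x\<bar> / l)) \<partial>lebesgue)
        \<le> (\<integral>\<^sup>+x\<in>{z<..<c}. ennreal (\<Phi> (\<bar>g x\<bar> / l)) \<partial>lebesgue)"
    proof (rule nn_integral_mono)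
      fix x
      show "ennreal (\<Phi> (\<bar>f x\<bar> / l)) * indicator {a<..<c} x \<le> ennreal (\<Phi> (\<bar>g x\<bar> / l)) * indicator {z<..<c} x"
      proof (cases "z < x \<and> x < c")
        case True
        then have "\<Phi> (\<bar>f x\<bar> / l) \<le> \<Phi> (\<bar>g x\<bar> / l)"
          using l le by (intro young_function_mono[OF \<Phi>]) (auto simp: divide_right_mono)
        then show ?thesis using True by (auto simp: indicator_def ennreal_leI)
      next
        case False
        moreover have "\<Phi> 0 = 0" using \<Phi> by (simp add: young_function_def)
        ultimately show ?thesis using zero[of x] by (cases "a < x \<and> x < c") (auto simp: indicator_def)
      qed
    qed
    also note int
    also have "ennreal (c - z) \<le> ennreal (c - a)" using assms(2) by (intro ennreal_leI) simp
    finally show ?thesis .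
  qed
  then show ?thesis
    unfolding luxemburg_Ioo[OF \<open>a < c\<close>] luxemburg_Ioo[OF \<open>z < c\<close>]
    by (intro INF_superset_mono) auto
qed

text \<open>
  A number \<open>l\<close> fails to be admissible for \<open>(x, x + h)\<close> exactly if \<open>\<Phi>(|f| / l)\<close> has average above 1
  there. This reduces measurability to that of \<open>maximal_plus\<close>.
\<close>

lemma maximal_young_plus_gt_iff:
  assumes \<Phi>: "young_function \<Phi>" and f: "f \<in> borel_measurable lebesgue" and "0 \<le> t"
  shows "ennreal t < maximal_young_plus \<Phi> f x \<longleftrightarrow>
    (\<exists>l>t. 1 < maximal_plus (\<lambda>y. \<Phi> (\<bar>f y\<bar> / l)) x)"
proof -
  let ?J = "\<lambda>l h. \<integral>\<^sup>+y\<in>{x<..<x + h}. ennreal (\<Phi> (\<bar>f y\<bar> / l)) \<partial>lebesgue"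
  have max_iff: "1 < maximal_plus (\<lambda>y. \<Phi> (\<bar>f y\<bar> / l)) x \<longleftrightarrow> (\<exists>h>0. ennreal h < ?J l h)" if "0 < l" for l
  proof -
    have "(\<integral>\<^sup>+y\<in>E. ennreal \<bar>\<Phi> (\<bar>f y\<bar> / l)\<bar> \<partial>lebesgue) = (\<integral>\<^sup>+y\<in>E. ennreal (\<Phi> (\<bar>f y\<bar> / l)) \<partial>lebesgue)" for E
      using young_function_nonneg[OF \<Phi>] that by (intro nn_integral_cong) (simp add: abs_of_nonneg)
    then show ?thesis
      using maximal_plus_gt_iff[OF young_function_measurable[OF \<Phi> f that], of 1]
      by (simp add: emeasure_integral_measure young_function_measurable[OF \<Phi> f that])
  qed
  show ?thesis
  proof
    assume "ennreal t < maximal_young_plus \<Phi> f x"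
    then obtain h where h: "0 < h" "ennreal t < luxemburg \<Phi> f {x<..<x + h}"
      by (auto simp: maximal_young_plus_def less_SUP_iff)
    obtain z where z: "ennreal t < z" "z < luxemburg \<Phi> f {x<..<x + h}"
      using dense[OF h(2)] by auto
    then obtain l where l: "z = ennreal l" "0 \<le> l"
      by (cases z rule: ennreal_cases) auto
    have "t < l" using z(1) \<open>0 \<le> t\<close> by (simp add: l ennreal_less_iff)
    have "\<not> ?J l h \<le> ennreal h"
    proof
      assume "?J l h \<le> ennreal h"
      then have "luxemburg \<Phi> f {x<..<x + h} \<le> ennreal l"
        using h(1) \<open>t < l\<close> \<open>0 \<le> t\<close> by (subst luxemburg_Ioo) (auto intro!: INF_lower)
      with z(2) l show False by simp
    qed
    then show "\<exists>l>t. 1 < maximal_plus (\<lambda>y. \<Phi> (\<bar>f y\<bar> / l)) x"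
      using \<open>t < l\<close> \<open>0 \<le> t\<close> h(1) max_iff[of l] by (auto simp: not_le)
  next
    assume "\<exists>l>t. 1 < maximal_plus (\<lambda>y. \<Phi> (\<bar>f y\<bar> / l)) x"
    then obtain l where "t < l" "1 < maximal_plus (\<lambda>y. \<Phi> (\<bar>f y\<bar> / l)) x" by blast
    then obtain h where h: "0 < h" "ennreal h < ?J l h" using max_iff[of l] \<open>0 \<le> t\<close> by auto
    have "ennreal t < ennreal l" using \<open>t < l\<close> \<open>0 \<le> t\<close> by (simp add: ennreal_less_iff)
    also have "ennreal l \<le> luxemburg \<Phi> f {x<..<x + h}"
      unfolding luxemburg_Ioo[OF less_add_same_cancel1[THEN iffD2, OF h(1)]]
    proof (rule INF_greatest)
      fix m assume m: "m \<in> {l. 0 < l \<and> ?J l h \<le> ennreal (x + h - x)}"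
      show "ennreal l \<le> ennreal m"
      proof (rule ccontr)
        assume "\<not> ennreal l \<le> ennreal m"
        then have "m \<le> l" using m by (auto simp: ennreal_le_iff2)
        have "?J l h \<le> ?J m h"
          using m \<open>m \<le> l\<close> \<open>t < l\<close> \<open>0 \<le> t\<close>
          by (intro nn_integral_mono mult_right_mono ennreal_leI young_function_mono[OF \<Phi>] divide_left_mono) auto
        with h m show False by auto
      qed
    qed
    also have "\<dots> \<le> maximal_young_plus \<Phi> f x"
      using h(1) by (auto simp: maximal_young_plus_def intro: SUP_upper)
    finally show "ennreal t < maximal_young_plus \<Phi> f x" .
  qed
qed

lemma maximal_young_plus_measurable:
  assumes \<Phi>: "young_function \<Phi>" and f: "f \<in> borel_measurable lebesgue"
  shows "maximal_young_plus \<Phi> f \<in> borel_measurable borel"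
proof (rule open_superlevel_measurable)
  fix t :: real assume "0 \<le> t"
  have "{x. ennreal t < maximal_young_plus \<Phi> f x}
      = (\<Union>l\<in>{t<..}. {x. ennreal 1 < maximal_plus (\<lambda>y. \<Phi> (\<bar>f y\<bar> / l)) x})"
    using maximal_young_plus_gt_iff[OF \<Phi> f \<open>0 \<le> t\<close>] by auto
  also have "open \<dots>"
    using \<open>0 \<le> t\<close> by (intro open_UN ballI open_maximal_plus_gt young_function_measurable[OF \<Phi> f]) auto
  finally show "open {x. ennreal t < maximal_young_plus \<Phi> f x}" .
qed

section \<open>The testing inequality\<close>

lemma conj_exp_powr:
  assumes "1 < p" and "0 \<le> (t :: real)"
  shows "t powr (1 / conj_exp p) * t powr (1 / p) = t"
proof (cases "t = 0")
  case False
  have "1 / conj_exp p + 1 / p = 1" using assms by (simp add: conj_exp_def field_simps)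
  then show ?thesis using False assms by (simp flip: powr_add)
qed simp

text \<open>
  The core of the testing inequality: one point at the level \<open>s\<close>, with the notation of the
  introduction. The indicator on the right keeps the estimates at different levels almost
  disjoint.
\<close>

lemma testing_level_estimate:
  fixes p \<kappa> s x :: real
  assumes \<Phi>: "young_function \<Phi>" and \<Psi>: "young_function \<Psi>" and "0 < \<kappa>"
    and prod: "\<And>u v. 0 \<le> u \<Longrightarrow> 0 \<le> v \<Longrightarrow> u * v \<le> \<kappa> * (\<Phi> u + \<Psi> v)"
    and p: "1 < p" and w: "weight w" and \<sigma>: "weight \<sigma>" and I: "is_interval I"
    and "x \<in> I" and "0 < s"
    and lower: "ennreal s < maximal_plus (\<lambda>y. \<sigma> y * indicator I y) x"
    and upper: "maximal_plus (\<lambda>y. \<sigma> y * indicator I y) x \<le> ennreal (2 * s)"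
  obtains h where "0 < h"
    "ennreal (s powr p) * weight_of w {x - h / 4<..<x + h / 4}
      \<le> ennreal (10 * (5 * \<kappa>) powr p) * A_plus_const p w \<sigma> \<Phi> *
        (\<integral>\<^sup>+z\<in>{x - h / 4<..<x + h / 4}.
           ennpowr (maximal_young_plus \<Psi> (\<lambda>y. \<sigma> y powr (1 / p) * indicator I y) z) p *
           indicator (I \<inter> {z. ennreal (s / 4) < maximal_plus (\<lambda>y. \<sigma> y * indicator I y) z \<and>
                               maximal_plus (\<lambda>y. \<sigma> y * indicator I y) z \<le> ennreal (16 * s)}) z \<partial>lebesgue)"
proof -
  define g where "g = (\<lambda>y. \<sigma> y * indicator I y)"
  define M where "M = maximal_plus g"
  define \<tau> where "\<tau> = (\<lambda>y. \<sigma> y powr (1 / p) * indicator I y)"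
  define G where "G = maximal_young_plus \<Psi> \<tau>"
  have I_meas [measurable]: "I \<in> sets lebesgue"
    using real_interval_borel_measurable[OF I] by simp
  have [measurable]: "\<sigma> \<in> borel_measurable lebesgue" "w \<in> borel_measurable lebesgue"
    and \<sigma>_nn: "\<And>y. 0 \<le> \<sigma> y" using \<sigma> w by (auto simp: weight_def)
  have g [measurable]: "g \<in> borel_measurable lebesgue" unfolding g_def by measurable
  have \<tau> [measurable]: "\<tau> \<in> borel_measurable lebesgue" unfolding \<tau>_def by measurable
  let ?m = "emeasure (integral_measure g)"
  obtain h where h: "0 < h" "ennreal s * ennreal h < ?m {x<..<x + h}"
    using lower g by (auto simp: maximal_plus_gt_iff simp flip: g_def)
  have le: "M x \<le> ennreal (2 * s)" using upper by (simp add: M_def g_def)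
  let ?J = "{x + h / 4<..<x + h}"
  let ?P = "{x - h / 4<..<x + h / 4}"
  let ?R = "{x - h / 4<..<x + h}"
  \<comment> \<open>The first quarter of \<open>(x, x + h)\<close> has mass at most \<open>2 s h / 4\<close>.\<close>
  have mJ: "ennreal (s * h / 2) \<le> ?m ?J"
  proof (rule ccontr)
    assume "\<not> ?thesis"
    then have small: "?m ?J < ennreal (s * h / 2)" by simp
    have "?m {x<..<x + h} \<le> ?m ({x..x + h / 4} \<union> ?J)" by (intro emeasure_mono) auto
    also have "\<dots> \<le> ?m {x..x + h / 4} + ?m ?J" by (intro emeasure_subadditive) auto
    also have "?m {x..x + h / 4} = ?m {x<..<x + h / 4}" by (rule emeasure_integral_measure_Icc[OF g])
    also have "\<dots> \<le> M x * ennreal (h / 4)" unfolding M_def using h by (intro maximal_plus_ge[OF g]) simp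
    also have "\<dots> \<le> ennreal (2 * s) * ennreal (h / 4)" by (intro mult_right_mono le) simp
    also have "\<dots> = ennreal (s * h / 2)" using \<open>0 < s\<close> h by (simp flip: ennreal_mult)
    finally have "?m {x<..<x + h} \<le> ennreal (s * h / 2) + ennreal (s * h / 2)"
      using small by (meson add_mono less_imp_le order.refl order_trans)
    also have "\<dots> = ennreal s * ennreal h"
      using \<open>0 < s\<close> h by (simp flip: ennreal_mult ennreal_plus)
    finally show False using h(2) by simp
  qed
  define N where "N = luxemburg \<Phi> (\<lambda>y. \<sigma> y powr (1 / conj_exp p) * indicator ?J y) ?R"
  define n where "n = luxemburg \<Psi> (\<lambda>y. \<tau> y * indicator ?J y) ?R"
  \<comment> \<open>The factor \<open>5 \<kappa>\<close> is \<open>2 \<kappa>\<close> times the ratio of the length \<open>5 h / 4\<close> to \<open>h / 2\<close>.\<close>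
  have s_le: "ennreal s \<le> ennreal (5 * \<kappa>) * (N * n)"
  proof -
    have eq: "\<sigma> y powr (1 / conj_exp p) * indicator ?J y * (\<tau> y * indicator ?J y) = g y * indicator ?J y" for y
      using conj_exp_powr[OF p \<sigma>_nn[of y]] by (simp add: \<tau>_def g_def indicator_def)
    have "ennreal (s * h / 2) \<le> ?m ?J" by (rule mJ)
    also have "\<dots> = (\<integral>\<^sup>+y\<in>?R. ennreal \<bar>\<sigma> y powr (1 / conj_exp p) * indicator ?J y * (\<tau> y
        * indicator ?J y)\<bar> \<partial>lebesgue)"
      unfolding eq using h by (auto simp: emeasure_integral_measure g indicator_def intro!: nn_integral_cong)
    also have "\<dots> \<le> ennreal (2 * \<kappa> * (x + h - (x - h / 4))) * (N * n)"
      unfolding N_def n_def using h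
      by (intro luxemburg_Holder[OF \<Phi> \<Psi> \<open>0 < \<kappa>\<close> prod]) auto
    also have "2 * \<kappa> * (x + h - (x - h / 4)) = h / 2 * (5 * \<kappa>)" by (simp add: field_simps)
    also have "ennreal (h / 2 * (5 * \<kappa>)) = ennreal (h / 2) * ennreal (5 * \<kappa>)"
      using h \<open>0 < \<kappa>\<close> by (intro ennreal_mult) auto
    finally have "ennreal (s * h / 2) \<le> ennreal (h / 2) * (ennreal (5 * \<kappa>) * (N * n))"
      by (simp only: mult.assoc)
    moreover have "ennreal (s * h / 2) = ennreal (h / 2) * ennreal s"
      using h \<open>0 < s\<close> by (subst ennreal_mult[symmetric]) (auto simp: mult_ac)
    ultimately have "ennreal (h / 2) * ennreal s \<le> ennreal (h / 2) * (ennreal (5 * \<kappa>) * (N * n))"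
      by metis
    then show ?thesis using h by (subst (asm) ennreal_mult_le_mult_iff) auto
  qed
  have A_le: "weight_of w ?P * ennpowr N p \<le> A_plus_const p w \<sigma> \<Phi> * ennreal (5 * h / 4)"
  proof -
    have "weight_of w ?P / ennreal (x + h - (x - h / 4)) * ennpowr N p \<le> A_plus_const p w \<sigma> \<Phi>"
      unfolding A_plus_const_def N_def using h
      by (intro SUP_upper2[where i = "(x - h / 4, x + h / 4, x + h)"]) auto
    then have "weight_of w ?P / ennreal (5 * h / 4) * ennpowr N p \<le> A_plus_const p w \<sigma> \<Phi>" by simp
    then have "weight_of w ?P / ennreal (5 * h / 4) * ennpowr N p * ennreal (5 * h / 4)
        \<le> A_plus_const p w \<sigma> \<Phi> * ennreal (5 * h / 4)"
      by (rule mult_right_mono) simp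
    moreover have "weight_of w ?P / ennreal (5 * h / 4) * ennreal (5 * h / 4) = weight_of w ?P"
      using h by (intro ennreal_divide_mult_cancel) simp
    ultimately show ?thesis by (metis mult.assoc mult.commute)
  qed
  have step: "ennreal (s powr p) * weight_of w ?P
      \<le> ennreal ((5 * \<kappa>) powr p) * ennpowr n p * (A_plus_const p w \<sigma> \<Phi> * ennreal (5 * h / 4))"
  proof -
    have "ennreal (s powr p) = ennpowr (ennreal s) p" using \<open>0 < s\<close> by (simp add: ennpowr_ennreal)
    also have "\<dots> \<le> ennpowr (ennreal (5 * \<kappa>) * (N * n)) p" using p by (intro ennpowr_mono s_le) simp
    also have "\<dots> = ennreal ((5 * \<kappa>) powr p) * (ennpowr N p * ennpowr n p)"
      using p \<open>0 < \<kappa>\<close> by (simp add: ennpowr_mult ennpowr_ennreal)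
    finally have "ennreal (s powr p) * weight_of w ?P
        \<le> ennreal ((5 * \<kappa>) powr p) * (ennpowr N p * ennpowr n p) * weight_of w ?P"
      by (rule mult_right_mono) simp
    also have "\<dots> = ennreal ((5 * \<kappa>) powr p) * ennpowr n p * (weight_of w ?P * ennpowr N p)"
      by (simp only: mult_ac)
    also have "\<dots> \<le> ennreal ((5 * \<kappa>) powr p) * ennpowr n p * (A_plus_const p w \<sigma> \<Phi> * ennreal (5 * h / 4))"
      by (intro mult_left_mono A_le) simp
    finally show ?thesis .
  qed
  have G_ge: "n \<le> G z" if z: "x < z" "z < x + h / 4" for z
  proof -
    have "n \<le> luxemburg \<Psi> \<tau> {z<..<x + h}"
      unfolding n_def using z h by (intro luxemburg_le_shrink[OF \<Psi>]) (auto simp: indicator_def)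
    also have "\<dots> = luxemburg \<Psi> \<tau> {z<..<z + (x + h - z)}" by simp
    also have "\<dots> \<le> G z" unfolding G_def maximal_young_plus_def
      using z h by (intro SUP_upper) simp
    finally show ?thesis .
  qed
  have sup_meas [measurable]: "{z. ennreal (16 * s) < M z} \<in> sets lebesgue"
    unfolding M_def using open_maximal_plus_gt[OF g] by (intro sets_completionI_sets) simp
  \<comment> \<open>The part of the gap \<open>(x, x + h / 4)\<close> that is charged to the level \<open>s\<close>. On the gap the maximal
    function is at least \<open>s / 2\<close> because \<open>J\<close> lies to the right of it.\<close>
  define S where "S = {x<..<x + h / 4} - {z. ennreal (16 * s) < M z}"
  have S_meas [measurable]: "S \<in> sets lebesgue" unfolding S_def by measurable
  have S_big: "ennreal (h / 8) \<le> emeasure lebesgue S"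
  proof -
    have "ennreal (h / 4) = emeasure lebesgue {x<..<x + h / 4}" using h by simp
    also have "\<dots> \<le> emeasure lebesgue (({x<..<x + h / 4} \<inter> {z. ennreal (16 * s) < M z}) \<union> S)"
      unfolding S_def by (intro emeasure_mono) auto
    also have "\<dots> \<le> emeasure lebesgue ({x<..<x + h / 4} \<inter> {z. ennreal (16 * s) < M z}) + emeasure lebesgue S"
      by (intro emeasure_subadditive) auto
    also have "emeasure lebesgue ({x<..<x + h / 4} \<inter> {z. ennreal (16 * s) < M z}) \<le> ennreal (h / 8)"
      using maximal_plus_superlevel_local[OF g, of "2 * s" "h / 4" x] le h \<open>0 < s\<close> by (simp add: M_def)
    finally have *: "ennreal (h / 4) \<le> ennreal (h / 8) + emeasure lebesgue S" by (simp add: add_right_mono)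
    have "ennreal (h / 4) = ennreal (h / 8) + ennreal (h / 8)" using h by (simp flip: ennreal_plus)
    with * show ?thesis by (simp add: ennreal_add_left_cancel_le)
  qed
  have S_sub: "z \<in> I \<and> ennreal (s / 4) < M z \<and> M z \<le> ennreal (16 * s)" if "z \<in> S" for z
  proof (intro conjI)
    have z: "x < z" "z < x + h / 4" "M z \<le> ennreal (16 * s)" using that by (auto simp: S_def)
    show "M z \<le> ennreal (16 * s)" by fact
    have "\<exists>y\<in>?J. y \<in> I"
    proof (rule ccontr)
      assume "\<not> ?thesis"
      then have "\<And>y. ennreal \<bar>g y\<bar> * indicator ?J y = 0" by (auto simp: g_def indicator_def)
      then have "?m ?J = 0"
        by (simp only: emeasure_integral_measure[OF g Ioo_lebesgue] nn_integral_const mult_zero_left)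
      with mJ \<open>0 < s\<close> h(1) show False by simp
    qed
    then obtain y where "y \<in> I" "x + h / 4 < y" by auto
    then show "z \<in> I" using I \<open>x \<in> I\<close> z by (meson is_interval_1 less_imp_le less_trans)
    have "ennreal (s / 2) * ennreal h = ennreal (s * h / 2)"
      using \<open>0 < s\<close> h by (simp flip: ennreal_mult)
    also have "\<dots> \<le> ?m ?J" by (rule mJ)
    also have "\<dots> \<le> ?m {z<..<z + (x + h - z)}" using z by (intro emeasure_mono) auto
    also have "\<dots> \<le> M z * ennreal (x + h - z)" unfolding M_def using z h by (intro maximal_plus_ge[OF g]) simp
    also have "\<dots> \<le> M z * ennreal h" using z by (intro mult_left_mono ennreal_leI) auto
    finally have "ennreal h * ennreal (s / 2) \<le> ennreal h * M z" by (simp only: mult.commute)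
    then have "ennreal (s / 2) \<le> M z" using h by (subst (asm) ennreal_mult_le_mult_iff) auto
    moreover have "ennreal (s / 4) < ennreal (s / 2)" using \<open>0 < s\<close> by (simp add: ennreal_less_iff)
    ultimately show "ennreal (s / 4) < M z" by simp
  qed
  have "ennpowr n p * ennreal (h / 8)
      \<le> ennpowr n p * emeasure lebesgue S" by (intro mult_left_mono S_big) simp
  also have "\<dots> = (\<integral>\<^sup>+z. ennpowr n p * indicator S z \<partial>lebesgue)"
    by (simp add: nn_integral_cmult_indicator)
  also have "\<dots> \<le> (\<integral>\<^sup>+z\<in>?P. ennpowr (G z) p *
      indicator (I \<inter> {z. ennreal (s / 4) < M z \<and> M z \<le> ennreal (16 * s)}) z \<partial>lebesgue)"
  proof (rule nn_integral_mono)
    fix z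
    show "ennpowr n p * indicator S z \<le> ennpowr (G z) p *
      indicator (I \<inter> {z. ennreal (s / 4) < M z \<and> M z \<le> ennreal (16 * s)}) z * indicator ?P z"
    proof (cases "z \<in> S")
      case True
      then have "x < z" "z < x + h / 4" by (auto simp: S_def)
      then have "ennpowr n p \<le> ennpowr (G z) p" using p by (intro ennpowr_mono G_ge) auto
      then show ?thesis using S_sub[OF True] True \<open>x < z\<close> \<open>z < x + h / 4\<close> h by simp
    qed simp
  qed
  finally have int: "ennpowr n p * ennreal (h / 8) \<le> (\<integral>\<^sup>+z\<in>?P. ennpowr (G z) p *
      indicator (I \<inter> {z. ennreal (s / 4) < M z \<and> M z \<le> ennreal (16 * s)}) z \<partial>lebesgue)" .
  \<comment> \<open>The length \<open>5 h / 4\<close> from the \<open>A\<^sub>p\<^sup>+\<close> condition has to be paid by a set of length \<open>h / 8\<close>.\<close>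
  have c: "ennreal (5 * h / 4) = ennreal 10 * ennreal (h / 8)"
    using h by (subst ennreal_mult[symmetric]) auto
  have "ennreal (s powr p) * weight_of w ?P
      \<le> ennreal ((5 * \<kappa>) powr p) * ennpowr n p * (A_plus_const p w \<sigma> \<Phi> * (ennreal 10 * ennreal (h / 8)))"
    using step unfolding c .
  also have "\<dots> = (ennreal 10 * ennreal ((5 * \<kappa>) powr p)) * A_plus_const p w \<sigma> \<Phi> * (ennpowr n p
      * ennreal (h / 8))"
    by (simp only: mult_ac)
  also have "ennreal 10 * ennreal ((5 * \<kappa>) powr p) = ennreal (10 * (5 * \<kappa>) powr p)"
    by (subst ennreal_mult) auto
  also have "ennreal (10 * (5 * \<kappa>) powr p) * A_plus_const p w \<sigma> \<Phi> * (ennpowr n p * ennreal (h / 8))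
    \<le> ennreal (10 * (5 * \<kappa>) powr p) * A_plus_const p w \<sigma> \<Phi> * (\<integral>\<^sup>+z\<in>?P. ennpowr (G z) p *
      indicator (I \<inter> {z. ennreal (s / 4) < M z \<and> M z \<le> ennreal (16 * s)}) z \<partial>lebesgue)"
    by (intro mult_left_mono int) simp
  finally show ?thesis using that[of h] h(1) unfolding M_def G_def g_def \<tau>_def by blast
qed

text \<open>
  The local estimate compares the measures \<open>s\<^sup>p w\<close> and \<open>C G\<^sup>p \<chi>\<close> on an interval around each point of
  the level set, where \<open>G\<close> is the Luxemburg maximal function; the covering inequality and a
  summation over \<open>s = 2\<^sup>k\<close> do the rest. Finite mass is needed for the levels to exhaust almost
  all points at which the maximal function is positive. The constant is a product of 2 from the
  covering inequality, 10 from the local estimate and 7 from the overlap of the levels; the width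
  \<open>2\<^sup>p\<close> of a level turns \<open>(5 \<kappa>)\<^sup>p\<close> into \<open>(10 \<kappa>)\<^sup>p\<close>.
\<close>

lemma testing_bound:
  fixes p \<kappa> :: real
  assumes \<Phi>: "young_function \<Phi>" and \<Psi>: "young_function \<Psi>" and "0 < \<kappa>"
    and prod: "\<And>u v. 0 \<le> u \<Longrightarrow> 0 \<le> v \<Longrightarrow> u * v \<le> \<kappa> * (\<Phi> u + \<Psi> v)"
    and p: "1 < p" and w: "weight w" and \<sigma>: "weight \<sigma>" and I: "is_interval I"
    and fin: "weight_of \<sigma> I \<noteq> top"
  shows "(\<integral>\<^sup>+x\<in>I. ennpowr (maximal_plus (\<lambda>y. \<sigma> y * indicator I y) x) p * ennreal (w x) \<partial>lebesgue)
    \<le> ennreal (140 * (10 * \<kappa>) powr p) * A_plus_const p w \<sigma> \<Phi> *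
      (\<integral>\<^sup>+x\<in>I. ennpowr (maximal_young_plus \<Psi> (\<lambda>y. \<sigma> y powr (1 / p) * indicator I y) x) p \<partial>lebesgue)"
proof -
  define g where "g = (\<lambda>y. \<sigma> y * indicator I y)"
  define M where "M = maximal_plus g"
  define G where "G = maximal_young_plus \<Psi> (\<lambda>y. \<sigma> y powr (1 / p) * indicator I y)"
  have I_meas [measurable]: "I \<in> sets lebesgue"
    using real_interval_borel_measurable[OF I] by simp
  have [measurable]: "\<sigma> \<in> borel_measurable lebesgue" "w \<in> borel_measurable lebesgue"
    and \<sigma>_nn: "\<And>y. 0 \<le> \<sigma> y" and w_nn: "\<And>y. 0 \<le> w y" using \<sigma> w by (auto simp: weight_def)
  have g [measurable]: "g \<in> borel_measurable lebesgue" unfolding g_def by measurable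
  have "M \<in> borel_measurable borel" unfolding M_def by (rule maximal_plus_measurable[OF g])
  then have M [measurable]: "M \<in> borel_measurable lebesgue" by (simp add: measurable_completion)
  have "G \<in> borel_measurable borel" unfolding G_def
    by (rule maximal_young_plus_measurable[OF \<Psi>]) measurable
  then have G [measurable]: "G \<in> borel_measurable lebesgue" by (simp add: measurable_completion)
  let ?W = "integral_measure w"
  define C where "C = ennreal (10 * (5 * \<kappa>) powr p) * A_plus_const p w \<sigma> \<Phi>"
  define E where "E k = I \<inter> {x. ennreal (2 powr real_of_int k) < M x \<and> M x \<le> ennreal (2
      * 2 powr real_of_int k)}" for k
  define D where "D k = I \<inter> {z. ennreal (2 powr real_of_int k / 4) < M z \<and> M z \<le> ennreal (16
      * 2 powr real_of_int k)}" for k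
  have E [measurable]: "E k \<in> sets lebesgue" for k unfolding E_def by measurable
  have D [measurable]: "D k \<in> sets lebesgue" for k unfolding D_def by measurable
  have W_eq: "emeasure ?W S = weight_of w S" if "S \<in> sets lebesgue" for S
    using that w_nn by (simp add: emeasure_integral_measure weight_of_def)
  have level: "ennreal (2 powr (k * p)) * emeasure ?W (E k)
      \<le> 2 * (C * (\<integral>\<^sup>+z. ennpowr (G z) p * indicator (D k) z \<partial>lebesgue))" for k :: int
  proof -
    define s where "s = 2 powr real_of_int k"
    have "0 < s" by (simp add: s_def)
    have sp: "2 powr (k * p) = s powr p" by (simp add: s_def powr_powr)
    define \<mu> where "\<mu> = density ?W (\<lambda>_. ennreal (s powr p))"
    define \<nu> where "\<nu> = density lebesgue (\<lambda>z. C * (ennpowr (G z) p * indicator (D k) z))"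
    have \<mu>: "emeasure \<mu> S = ennreal (s powr p) * emeasure ?W S" if "S \<in> sets lebesgue" for S
      using that unfolding \<mu>_def by (subst emeasure_density) (auto simp: nn_integral_cmult_indicator)
    have \<nu>: "emeasure \<nu> S = C * (\<integral>\<^sup>+z\<in>S. ennpowr (G z) p * indicator (D k) z \<partial>lebesgue)"
      if [measurable]: "S \<in> sets lebesgue" for S
      unfolding \<nu>_def by (subst emeasure_density) (simp_all add: nn_integral_cmult mult.assoc)
    define F where "F = {(a, b). emeasure \<mu> {a<..<b} \<le> emeasure \<nu> {a<..<b}}"
    have "E k \<subseteq> (\<Union>(a, b)\<in>F. {a<..<b})"
    proof
      fix x assume x: "x \<in> E k"
      obtain h where h: "0 < h" "ennreal (s powr p) * weight_of w {x - h / 4<..<x + h / 4}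
        \<le> C * (\<integral>\<^sup>+z\<in>{x - h / 4<..<x + h / 4}. ennpowr (G z) p * indicator (D k) z \<partial>lebesgue)"
        using testing_level_estimate[OF \<Phi> \<Psi> \<open>0 < \<kappa>\<close> prod p w \<sigma> I _ \<open>0 < s\<close>, of x] x
        unfolding E_def D_def C_def M_def g_def G_def s_def by blast
      have "(x - h / 4, x + h / 4) \<in> F" using h(2) by (simp add: F_def \<mu> \<nu> W_eq)
      then show "x \<in> (\<Union>(a, b)\<in>F. {a<..<b})"
        using h(1) by (intro UN_I[of "(x - h / 4, x + h / 4)"]) simp_all
    qed
    moreover have op: "open (\<Union>(a, b)\<in>F. {a<..<b})" by (intro open_UN ballI) (simp add: case_prod_beta)
    ultimately have "emeasure \<mu> (E k) \<le> emeasure \<mu> (\<Union>(a, b)\<in>F. {a<..<b})"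
      by (intro emeasure_mono) (simp_all add: \<mu>_def)
    also have "\<dots> \<le> 2 * emeasure \<nu> UNIV"
      by (rule emeasure_Union_Ioo_le) (simp_all add: \<mu>_def \<nu>_def F_def)
    finally show ?thesis by (simp add: \<mu> \<nu> sp)
  qed
  have "emeasure (integral_measure g) UNIV = weight_of \<sigma> I"
    using \<sigma>_nn by (auto simp: emeasure_integral_measure weight_of_def g_def indicator_def intro!: nn_integral_cong)
  then have M_fin: "AE x in lebesgue. M x < top"
    unfolding M_def using fin by (intro AE_maximal_plus_finite[OF g]) (simp add: top.not_eq_extremum)
  have "(\<integral>\<^sup>+x\<in>I. ennpowr (M x) p * ennreal (w x) \<partial>lebesgue)
    \<le> (\<integral>\<^sup>+x. \<integral>\<^sup>+k. ennreal (2 powr p) * ennreal (2 powr (real_of_int k * p)) * (ennreal (w x)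
    * indicator (E k) x) \<partial>count_space UNIV \<partial>lebesgue)"
  proof (rule nn_integral_mono_AE)
    show "AE x in lebesgue. ennpowr (M x) p * ennreal (w x) * indicator I x
      \<le> (\<integral>\<^sup>+k. ennreal (2 powr p) * ennreal (2 powr (real_of_int k * p)) * (ennreal (w x)
      * indicator (E k) x) \<partial>count_space UNIV)"
      using M_fin
    proof eventually_elim
      fix x assume "M x < top"
      show "ennpowr (M x) p * ennreal (w x) * indicator I x
      \<le> (\<integral>\<^sup>+k. ennreal (2 powr p) * ennreal (2 powr (real_of_int k * p)) * (ennreal (w x)
      * indicator (E k) x) \<partial>count_space UNIV)"
      proof (cases "x \<in> I \<and> 0 < M x")
        case True
        obtain k where k: "ennreal (2 powr real_of_int k) < M x" "M x \<le> ennreal (2 powr (real_of_int k + 1))"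
          by (rule dyadic_level[OF conjunct2[OF True] \<open>M x < top\<close>])
        have "x \<in> E k" using True k by (simp add: E_def powr_add mult.commute)
        have "ennpowr (M x) p \<le> ennpowr (ennreal (2 powr (real_of_int k + 1))) p"
          using p k by (intro ennpowr_mono) auto
        also have "\<dots> = ennreal (2 powr p) * ennreal (2 powr (real_of_int k * p))"
        proof -
          have "(2 powr (real_of_int k + 1)) powr p = 2 powr (p + real_of_int k * p)"
            by (simp only: powr_powr) (simp add: algebra_simps)
          then have "(2 powr (real_of_int k + 1)) powr p = 2 powr p * 2 powr (real_of_int k * p)"
            by (simp only: powr_add)
          then show ?thesis by (simp add: ennpowr_ennreal ennreal_mult)
        qed
        finally have "ennpowr (M x) p * ennreal (w x) * indicator I x
          \<le> ennreal (2 powr p) * ennreal (2 powr (real_of_int k * p)) * (ennreal (w x) * indicator (E k) x)"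
          using True \<open>x \<in> E k\<close> by (simp add: mult_right_mono)
        also have "\<dots> \<le> (\<integral>\<^sup>+k. ennreal (2 powr p) * ennreal (2 powr (real_of_int k * p)) * (ennreal (w x)
            * indicator (E k) x) \<partial>count_space UNIV)"
          by (rule nn_integral_count_space_ge) simp
        finally show ?thesis .
      next
        case False
        then have "ennpowr (M x) p * ennreal (w x) * indicator I x = 0" by (auto simp: indicator_def)
        then show ?thesis by (simp only: zero_le)
      qed
    qed
  qed
  also have "\<dots> = (\<integral>\<^sup>+k. \<integral>\<^sup>+x. ennreal (2 powr p) * ennreal (2 powr (real_of_int k * p)) * (ennreal (w x)
      * indicator (E k) x) \<partial>lebesgue \<partial>count_space UNIV)"
    by (rule nn_integral_count_space_nn_integral) (auto intro!: borel_measurable_times)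
  also have "\<dots> = (\<integral>\<^sup>+k. ennreal (2 powr p) * (ennreal (2 powr (real_of_int k * p)) * emeasure ?W (E k))
      \<partial>count_space UNIV)"
    by (intro nn_integral_cong) (simp add: nn_integral_cmult W_eq weight_of_def mult.assoc)
  also have "\<dots> \<le> (\<integral>\<^sup>+k. ennreal (2 powr p) * (2 * (C * (\<integral>\<^sup>+z. ennpowr (G z) p * indicator (D k) z
      \<partial>lebesgue))) \<partial>count_space UNIV)"
    by (intro nn_integral_mono mult_left_mono level) simp
  also have "\<dots> = ennreal (2 powr p) * (2 * (C * (\<integral>\<^sup>+k. \<integral>\<^sup>+z. ennpowr (G z) p * indicator (D k) z
      \<partial>lebesgue \<partial>count_space (UNIV :: int set))))"
    by (simp add: nn_integral_cmult)
  also have "(\<integral>\<^sup>+k. \<integral>\<^sup>+z. ennpowr (G z) p * indicator (D k) z \<partial>lebesgue \<partial>count_space (UNIV :: int set))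
     = (\<integral>\<^sup>+z. \<integral>\<^sup>+k. ennpowr (G z) p * indicator (D k) z \<partial>count_space (UNIV :: int set) \<partial>lebesgue)"
    by (rule nn_integral_count_space_nn_integral[symmetric]) (auto intro!: borel_measurable_times)
  also have "\<dots> \<le> (\<integral>\<^sup>+z. 7 * (ennpowr (G z) p * indicator I z) \<partial>lebesgue)"
  proof (rule nn_integral_mono)
    fix z
    have "(\<integral>\<^sup>+k. ennpowr (G z) p * indicator (D k) z \<partial>count_space (UNIV :: int set))
      = (\<integral>\<^sup>+k. ennpowr (G z) p * indicator I z * of_bool (ennreal (2 powr real_of_int k / 4) < M z \<and> M z
          \<le> ennreal (16 * 2 powr real_of_int k)) \<partial>count_space (UNIV :: int set))"
      by (intro nn_integral_cong) (simp add: D_def indicator_def)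
    also have "\<dots> = ennpowr (G z) p * indicator I z
        * (\<integral>\<^sup>+k. of_bool (ennreal (2 powr real_of_int k / 4) < M z \<and> M z \<le> ennreal (16
            * 2 powr real_of_int k)) \<partial>count_space (UNIV :: int set))"
      by (rule nn_integral_cmult) simp
    also have "\<dots> \<le> ennpowr (G z) p * indicator I z * 7"
      by (intro mult_left_mono dyadic_overlap) simp
    finally show "(\<integral>\<^sup>+k. ennpowr (G z) p * indicator (D k) z \<partial>count_space (UNIV :: int set)) \<le> 7
        * (ennpowr (G z) p * indicator I z)"
      by (simp add: mult.commute)
  qed
  also have "\<dots> = 7 * (\<integral>\<^sup>+z\<in>I. ennpowr (G z) p \<partial>lebesgue)"
    by (rule nn_integral_cmult) measurable
  finally have "(\<integral>\<^sup>+x\<in>I. ennpowr (M x) p * ennreal (w x) \<partial>lebesgue)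
    \<le> ennreal (2 powr p) * (2 * (C * (7 * (\<integral>\<^sup>+z\<in>I. ennpowr (G z) p \<partial>lebesgue))))"
    by (simp add: mult_left_mono)
  also have "\<dots> = (ennreal (2 powr p) * 2 * ennreal (10 * (5 * \<kappa>) powr p) * 7) * A_plus_const p w \<sigma> \<Phi>
      * (\<integral>\<^sup>+z\<in>I. ennpowr (G z) p \<partial>lebesgue)"
    by (simp only: C_def mult_ac)
  also have "ennreal (2 powr p) * 2 * ennreal (10 * (5 * \<kappa>) powr p) * 7 = ennreal (140 * (10 * \<kappa>) powr p)"
  proof -
    define A B where "A = 2 powr p" and "B = (5 * \<kappa>) powr p"
    have "(10 * \<kappa>) powr p = A * B"
      using \<open>0 < \<kappa>\<close> powr_mult[of 2 "5 * \<kappa>" p] by (simp add: A_def B_def)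
    then have "ennreal (140 * (10 * \<kappa>) powr p) = (2 * 10 * 7) * (ennreal A * ennreal B)"
      by (simp add: ennreal_mult A_def B_def)
    also have "\<dots> = ennreal A * 2 * (10 * ennreal B) * 7" by (simp only: mult_ac)
    also have "10 * ennreal B = ennreal (10 * B)" by (simp add: ennreal_mult B_def)
    finally show ?thesis by (simp only: A_def B_def)
  qed
  finally show ?thesis unfolding M_def G_def g_def .
qed

text \<open>
  Unbounded intervals are exhausted by bounded ones; the components of the sets in the next
  part may be unbounded.
\<close>

lemma testing_interval:
  assumes p: "1 < p" and w: "weight w" and \<sigma>: "weight \<sigma>"
    and test: "\<And>I. is_interval I \<Longrightarrow> bounded I \<Longrightarrow>
      (\<integral>\<^sup>+x\<in>I. ennpowr (maximal_plus (\<lambda>y. \<sigma> y * indicator I y) x) p * ennreal (w x) \<partial>lebesgue)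
        \<le> K * weight_of \<sigma> I"
    and L: "is_interval L"
  shows "(\<integral>\<^sup>+x\<in>L. ennpowr (maximal_plus (\<lambda>y. \<sigma> y * indicator L y) x) p * ennreal (w x) \<partial>lebesgue)
        \<le> K * weight_of \<sigma> L"
proof -
  define J where "J n = L \<inter> {- real n<..<real n}" for n
  have J: "is_interval (J n)" "bounded (J n)" for n
    unfolding J_def using L by (auto intro!: is_interval_Int is_interval_oo bounded_Int)
  have [measurable]: "L \<in> sets lebesgue" using real_interval_borel_measurable[OF L] by simp
  have [measurable]: "J n \<in> sets lebesgue" for n using real_interval_borel_measurable[OF J(1)] by simp
  have [measurable]: "\<sigma> \<in> borel_measurable lebesgue" "w \<in> borel_measurable lebesgue"
    using \<sigma> w by (auto simp: weight_def)
  define M where "M A = maximal_plus (\<lambda>y. \<sigma> y * indicator A y)" for A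
  have gm [measurable]: "(\<lambda>y. \<sigma> y * indicator A y) \<in> borel_measurable lebesgue" if "A \<in> sets lebesgue" for A
    using that by measurable
  have M_meas: "M A \<in> borel_measurable lebesgue" if "A \<in> sets lebesgue" for A
    using maximal_plus_measurable[OF gm[OF that]] unfolding M_def by (simp add: measurable_completion)
  have M_eq: "M A x = (SUP h\<in>{0<..}. emeasure (integral_measure \<sigma>) ({x<..<x + h} \<inter> A) / ennreal h)"
    if "A \<in> sets lebesgue" for A x
    unfolding M_def maximal_plus_eq[OF gm[OF that]]
    using that by (intro SUP_cong refl) (subst emeasure_integral_measure_restrict, auto)
  have M_mono: "M A x \<le> M B x" if "A \<subseteq> B" "A \<in> sets lebesgue" "B \<in> sets lebesgue" for A B x
    unfolding M_eq[OF that(2)] M_eq[OF that(3)] using that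
    by (intro SUP_mono' divide_right_mono_ennreal emeasure_mono) auto
  define v where "v n x = M (J n) x * indicator (J n) x" for n x
  have J_mono: "J m \<subseteq> J n" if "m \<le> n" for m n using that by (auto simp: J_def)
  have v_mono: "v m x \<le> v n x" if "m \<le> n" for m n x
    unfolding v_def using J_mono[OF that] by (intro mult_mono M_mono) (auto simp: indicator_def)
  have sup: "M L x * indicator L x \<le> (SUP n. v n x)" for x
  proof (cases "x \<in> L")
    case True
    have "M L x \<le> (SUP n. v n x)"
      unfolding M_eq[OF \<open>L \<in> sets lebesgue\<close>]
    proof (rule SUP_least)
      fix h :: real assume "h \<in> {0<..}"
      obtain n where n: "\<bar>x\<bar> + h < real n" using reals_Archimedean2 by blast
      have "x \<in> J n" using True n \<open>h \<in> {0<..}\<close> by (auto simp: J_def)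
      have "{x<..<x + h} \<inter> L = {x<..<x + h} \<inter> J n" using n by (auto simp: J_def)
      then have "emeasure (integral_measure \<sigma>) ({x<..<x + h} \<inter> L) / ennreal h \<le> M (J n) x"
        unfolding M_eq[OF \<open>J n \<in> sets lebesgue\<close>] using \<open>h \<in> {0<..}\<close> by (intro SUP_upper2[of h]) auto
      also have "\<dots> = v n x" using \<open>x \<in> J n\<close> by (simp add: v_def)
      also have "\<dots> \<le> (SUP n. v n x)" by (intro SUP_upper) simp
      finally show "emeasure (integral_measure \<sigma>) ({x<..<x + h} \<inter> L) / ennreal h \<le> (SUP n. v n x)" .
    qed
    then show ?thesis using True by simp
  qed simp
  have ind: "ennpowr (t * indicator A x) p = ennpowr t p * indicator A x" for t :: ennreal and A and x :: real
    by (simp add: indicator_def)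
  have "(\<integral>\<^sup>+x\<in>L. ennpowr (M L x) p * ennreal (w x) \<partial>lebesgue)
    = (\<integral>\<^sup>+x. ennpowr (M L x * indicator L x) p * ennreal (w x) \<partial>lebesgue)"
    unfolding ind by (intro nn_integral_cong) (simp add: mult_ac)
  also have "\<dots> \<le> (\<integral>\<^sup>+x. (SUP n. ennpowr (v n x) p * ennreal (w x)) \<partial>lebesgue)"
  proof (rule nn_integral_mono)
    fix x
    have "ennpowr (M L x * indicator L x) p \<le> ennpowr (SUP n. v n x) p"
      using p by (intro ennpowr_mono sup) simp
    also have "\<dots> \<le> (SUP n. ennpowr (v n x) p)"
      using p by (subst ennpowr_SUP_le_iff) (auto intro: SUP_upper)
    finally have "ennpowr (M L x * indicator L x) p * ennreal (w x) \<le> (SUP n. ennpowr (v n x) p)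
        * ennreal (w x)"
      by (rule mult_right_mono) simp
    then show "ennpowr (M L x * indicator L x) p * ennreal (w x) \<le> (SUP n. ennpowr (v n x) p * ennreal (w x))"
      by (simp add: SUP_mult_right_ennreal)
  qed
  also have "\<dots> = (SUP n. \<integral>\<^sup>+x. ennpowr (v n x) p * ennreal (w x) \<partial>lebesgue)"
  proof (rule nn_integral_monotone_convergence_SUP)
    show "incseq (\<lambda>n x. ennpowr (v n x) p * ennreal (w x))"
      using p v_mono by (intro incseq_SucI le_funI mult_right_mono ennpowr_mono) auto
    show "(\<lambda>x. ennpowr (v n x) p * ennreal (w x)) \<in> borel_measurable lebesgue" for n
      unfolding v_def using M_meas[of "J n"] by measurable
  qed
  also have "\<dots> \<le> K * weight_of \<sigma> L"
  proof (rule SUP_least)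
    fix n
    have "(\<integral>\<^sup>+x. ennpowr (v n x) p * ennreal (w x) \<partial>lebesgue)
      = (\<integral>\<^sup>+x\<in>J n. ennpowr (M (J n) x) p * ennreal (w x) \<partial>lebesgue)"
      unfolding v_def ind by (intro nn_integral_cong) (simp add: mult_ac)
    also have "\<dots> \<le> K * weight_of \<sigma> (J n)" unfolding M_def by (rule test[OF J])
    also have "\<dots> \<le> K * weight_of \<sigma> L"
      unfolding weight_of_def by (intro mult_left_mono nn_integral_mono) (auto simp: J_def indicator_def)
    finally show "(\<integral>\<^sup>+x. ennpowr (v n x) p * ennreal (w x) \<partial>lebesgue) \<le> K * weight_of \<sigma> L" .
  qed
  finally show ?thesis unfolding M_def .
qed

section \<open>From testing to all functions\<close>

text \<open>
  The set on which the uncentred maximal function of \<open>f\<close> with respect to the measure \<open>\<sigma>\<close>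
  exceeds \<open>t\<close>, written with products because \<open>\<sigma>\<close> may vanish on an interval.
\<close>

definition average_superlevel :: "(real \<Rightarrow> real) \<Rightarrow> (real \<Rightarrow> real) \<Rightarrow> real \<Rightarrow> real set" where
  "average_superlevel \<sigma> f t =
    (\<Union>(a, b)\<in>{(a, b). ennreal t * weight_of \<sigma> {a<..<b} < weight_of (\<lambda>x. \<bar>f x\<bar> * \<sigma> x) {a<..<b}}. {a<..<b})"

lemma open_average_superlevel: "open (average_superlevel \<sigma> f t)"
  unfolding average_superlevel_def by (intro open_UN ballI) (simp add: case_prod_beta)

text \<open>
  The weak type (1,1) bound for the truncation of \<open>f\<close> to \<open>{|f| > t/2}\<close>: the rest of \<open>f\<close> contributes at
  most \<open>t/2\<close> to every average.
\<close>

lemma weight_of_average_superlevel_le: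
  assumes \<sigma>: "weight \<sigma>" and fin: "\<And>a b. weight_of \<sigma> {a<..<b} < top"
    and f [measurable]: "f \<in> borel_measurable lebesgue" and "0 < t"
  shows "ennreal t * weight_of \<sigma> (average_superlevel \<sigma> f t)
    \<le> 4 * (\<integral>\<^sup>+x. ennreal \<bar>f x\<bar> * of_bool (t < 2 * \<bar>f x\<bar>) \<partial>integral_measure \<sigma>)"
proof -
  let ?S = "integral_measure \<sigma>"
  define \<mu> where "\<mu> = density ?S (\<lambda>_. ennreal (t / 2))"
  define \<nu> where "\<nu> = density ?S (\<lambda>x. ennreal \<bar>f x\<bar> * of_bool (t < 2 * \<bar>f x\<bar>))"
  have [measurable]: "(\<lambda>x. ennreal \<bar>f x\<bar> * of_bool (t < 2 * \<bar>f x\<bar>)) \<in> borel_measurable ?S" by measurable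
  have \<mu>: "emeasure \<mu> A = ennreal (t / 2) * weight_of \<sigma> A" if "A \<in> sets lebesgue" for A
    using that unfolding \<mu>_def
        by (subst emeasure_density) (auto simp: nn_integral_cmult_indicator weight_of_eq_emeasure[OF \<sigma>])
  have \<nu>: "emeasure \<nu> A = (\<integral>\<^sup>+x. ennreal \<bar>f x\<bar> * of_bool (t < 2 * \<bar>f x\<bar>) * indicator A x \<partial>?S)"
    if "A \<in> sets lebesgue" for A
    using that unfolding \<nu>_def by (subst emeasure_density) auto
  let ?U = "average_superlevel \<sigma> f t"
  have U: "?U \<in> sets lebesgue" using open_average_superlevel by (intro sets_completionI_sets) simp
  have "emeasure \<mu> ?U \<le> 2 * emeasure \<nu> UNIV"
    unfolding average_superlevel_def
  proof (rule emeasure_Union_Ioo_le)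
    fix a b assume "(a, b) \<in> {(a, b). ennreal t * weight_of \<sigma> {a<..<b} < weight_of (\<lambda>x. \<bar>f x\<bar> * \<sigma> x) {a<..<b}}"
    then have lt: "ennreal t * weight_of \<sigma> {a<..<b} < weight_of (\<lambda>x. \<bar>f x\<bar> * \<sigma> x) {a<..<b}" by simp
    let ?s = "weight_of \<sigma> {a<..<b}"
    have "ennreal (t / 2) * ?s + ennreal (t / 2) * ?s = ennreal t * ?s"
      using \<open>0 < t\<close> by (simp flip: distrib_right ennreal_plus)
    also have "\<dots> \<le> weight_of (\<lambda>x. \<bar>f x\<bar> * \<sigma> x) {a<..<b}" using lt by simp
    also have "\<dots> = (\<integral>\<^sup>+x\<in>{a<..<b}. ennreal \<bar>f x\<bar> \<partial>?S)"
      by (rule weight_of_mult_eq(2)[OF \<sigma> f]) simp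
    also have "\<dots> \<le> (\<integral>\<^sup>+x. ennreal (t / 2) * indicator {a<..<b} x
        + ennreal \<bar>f x\<bar> * of_bool (t < 2 * \<bar>f x\<bar>) * indicator {a<..<b} x \<partial>?S)"
    proof (rule nn_integral_mono)
      fix x
      have "\<bar>f x\<bar> \<le> t / 2" if "\<not> t < 2 * \<bar>f x\<bar>" using that by simp
      then show "ennreal \<bar>f x\<bar> * indicator {a<..<b} x \<le> ennreal (t / 2) * indicator {a<..<b} x
        + ennreal \<bar>f x\<bar> * of_bool (t < 2 * \<bar>f x\<bar>) * indicator {a<..<b} x"
        by (cases "t < 2 * \<bar>f x\<bar>"; cases "x \<in> {a<..<b}") (simp_all add: ennreal_leI)
    qed
    also have "\<dots> = ennreal (t / 2) * ?s + emeasure \<nu> {a<..<b}"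
      by (subst nn_integral_add) (simp_all add: \<nu> nn_integral_cmult_indicator weight_of_eq_emeasure[OF \<sigma>])
    finally have "ennreal (t / 2) * ?s \<le> emeasure \<nu> {a<..<b}"
      using fin[of a b] by (subst (asm) ennreal_add_left_cancel_le) (auto simp: ennreal_mult_eq_top_iff)
    then show "emeasure \<mu> {a<..<b} \<le> emeasure \<nu> {a<..<b}" by (simp add: \<mu>)
  qed (simp_all add: \<mu>_def \<nu>_def)
  then have "2 * (ennreal (t / 2) * weight_of \<sigma> ?U) \<le> 2 * (2 * emeasure \<nu> UNIV)"
    unfolding \<mu>[OF U] by (intro mult_left_mono) simp_all
  moreover have "2 * (ennreal (t / 2) * weight_of \<sigma> ?U) = ennreal t * weight_of \<sigma> ?U"
  proof -
    have "2 * ennreal (t / 2) = ennreal t" using \<open>0 < t\<close> by (simp flip: ennreal_numeral ennreal_mult)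
    then show ?thesis by (metis mult.assoc)
  qed
  moreover have "2 * (2 * emeasure \<nu> UNIV) = 4 * emeasure \<nu> UNIV"
  proof -
    have "(2 * 2 :: ennreal) = 4" by simp
    then show ?thesis by (metis mult.assoc)
  qed
  ultimately show ?thesis by (simp add: \<nu>)
qed

text \<open>
  The base point \<open>x\<close> itself has to belong to the open set. As \<open>\<sigma>\<close> has no atoms, a slightly longer
  interval starting to the left of \<open>x\<close> still has large average.
\<close>

lemma Ioo_subset_average_superlevel:
  assumes \<sigma>: "weight \<sigma>" and fin: "\<And>a b. weight_of \<sigma> {a<..<b} < top"
    and f: "f \<in> borel_measurable lebesgue" and "0 < t" "0 < h"
    and gt: "ennreal t * weight_of \<sigma> {x<..<x + h} < weight_of (\<lambda>x. \<bar>f x\<bar> * \<sigma> x) {x<..<x + h}"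
  obtains a where "a < x" "{a<..<x + h} \<subseteq> average_superlevel \<sigma> f t"
proof -
  let ?S = "integral_measure \<sigma>" and ?X = "weight_of (\<lambda>x. \<bar>f x\<bar> * \<sigma> x) {x<..<x + h}"
  have \<sigma>_meas: "\<sigma> \<in> borel_measurable lebesgue" using \<sigma> by (simp add: weight_def)
  have S: "weight_of \<sigma> {a<..<b} = emeasure ?S {a<..<b}" for a b
    by (rule weight_of_eq_emeasure[OF \<sigma>]) simp
  define A where "A n = {x - inverse (real (Suc n))<..<x + h}" for n
  have pos: "0 < inverse (real (Suc n))" for n by simp
  have INT: "(\<Inter>n. A n) = {x..<x + h}"
  proof (intro equalityI subsetI)
    fix y assume y: "y \<in> (\<Inter>n. A n)"
    have "x \<le> y"
    proof (rule ccontr)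
      assume "\<not> x \<le> y"
      then obtain n where "inverse (real (Suc n)) < x - y"
        using reals_Archimedean[of "x - y"] by auto
      moreover have "x - inverse (real (Suc n)) < y"
        using y unfolding A_def by (simp only: INT_iff greaterThanLessThan_iff UNIV_I)
      ultimately show False by linarith
    qed
    moreover have "y < x + h" using y by (auto simp: A_def)
    ultimately show "y \<in> {x..<x + h}" by simp
  next
    fix y assume "y \<in> {x..<x + h}"
    then have "y \<in> A n" for n
      using pos[of n] unfolding A_def greaterThanLessThan_iff atLeastLessThan_iff by linarith
    then show "y \<in> (\<Inter>n. A n)" by (intro INT_I)
  qed
  have dec: "decseq A"
  proof (rule decseq_SucI)
    fix n
    have "inverse (real (Suc (Suc n))) \<le> inverse (real (Suc n))" by (intro le_imp_inverse_le) auto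
    then have "y \<in> A n" if "y \<in> A (Suc n)" for y
      using that unfolding A_def greaterThanLessThan_iff by linarith
    then show "A (Suc n) \<subseteq> A n" by (intro subsetI)
  qed
  have "(INF n. emeasure ?S (A n)) = emeasure ?S (\<Inter>n. A n)"
  proof (rule INF_emeasure_decseq[OF _ dec])
    show "range A \<subseteq> sets ?S" by (auto simp: A_def)
    show "emeasure ?S (A n) \<noteq> \<infinity>" for n using fin unfolding A_def S by (simp add: less_top)
  qed
  also have "\<dots> \<le> emeasure ?S {x..x + h}" unfolding INT by (intro emeasure_mono) auto
  also have "\<dots> = weight_of \<sigma> {x<..<x + h}" unfolding S by (rule emeasure_integral_measure_Icc[OF \<sigma>_meas])
  finally have INF: "(INF n. emeasure ?S (A n)) \<le> weight_of \<sigma> {x<..<x + h}" .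
  have "\<exists>n. ennreal t * emeasure ?S (A n) < ?X"
  proof (rule ccontr)
    assume "\<not> ?thesis"
    then have "?X \<le> ennreal t * emeasure ?S (A n)" for n by (simp add: not_less)
    then have "?X \<le> ennreal t * (INF n. emeasure ?S (A n))"
      using \<open>0 < t\<close> by (intro ennreal_le_mult_INF) auto
    also have "\<dots> \<le> ennreal t * weight_of \<sigma> {x<..<x + h}" by (intro mult_left_mono INF) simp
    finally show False using gt by simp
  qed
  then obtain n where n: "ennreal t * emeasure ?S (A n) < ?X" ..
  define a where "a = x - inverse (real (Suc n))"
  have "a < x" using pos[of n] by (simp add: a_def)
  have "?X \<le> weight_of (\<lambda>x. \<bar>f x\<bar> * \<sigma> x) {a<..<x + h}"
    unfolding weight_of_def using \<open>a < x\<close> by (intro nn_integral_mono) (auto simp: indicator_def)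
  then have "ennreal t * weight_of \<sigma> {a<..<x + h} < weight_of (\<lambda>x. \<bar>f x\<bar> * \<sigma> x) {a<..<x + h}"
    using n unfolding S A_def a_def by (rule less_le_trans[rotated])
  then have "{a<..<x + h} \<subseteq> average_superlevel \<sigma> f t"
    unfolding average_superlevel_def by (intro subsetI UN_I[of "(a, x + h)"]) simp_all
  with \<open>a < x\<close> show ?thesis by (rule that)
qed

text \<open>
  For each \<open>h\<close> a single term of the double sum suffices: \<open>l\<close> is the dyadic level of the
  \<open>\<sigma>\<close>-average of \<open>|f|\<close> over \<open>(x, x + h)\<close>, and \<open>L\<close> is the component that contains this interval.
\<close>

lemma maximal_plus_pointwise_dyadic:
  assumes p: "1 < p" and \<sigma>: "weight \<sigma>" and fin: "\<And>a b. weight_of \<sigma> {a<..<b} < top"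
    and f: "f \<in> borel_measurable lebesgue"
    and fin_f: "\<And>a b. weight_of (\<lambda>x. \<bar>f x\<bar> * \<sigma> x) {a<..<b} < top"
  shows "ennpowr (maximal_plus (\<lambda>y. f y * \<sigma> y) x) p \<le>
    (\<integral>\<^sup>+l. ennreal (2 powr ((real_of_int l + 1) * p)) *
       (\<integral>\<^sup>+L. indicator L x * ennpowr (maximal_plus (\<lambda>y. \<sigma> y * indicator L y) x) p
          \<partial>count_space (components (average_superlevel \<sigma> f (2 powr real_of_int l)))) \<partial>count_space UNIV)"
    (is "_ \<le> ?R")
proof -
  have \<sigma>_meas [measurable]: "\<sigma> \<in> borel_measurable lebesgue" using \<sigma> by (simp add: weight_def)
  have [measurable]: "(\<lambda>y. f y * \<sigma> y) \<in> borel_measurable lebesgue" using f by measurable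
  have "ennpowr (weight_of (\<lambda>x. \<bar>f x\<bar> * \<sigma> x) {x<..<x + h} / ennreal h) p \<le> ?R" if "0 < h" for h
  proof (cases "weight_of (\<lambda>x. \<bar>f x\<bar> * \<sigma> x) {x<..<x + h} = 0")
    case False
    define X where "X = weight_of (\<lambda>x. \<bar>f x\<bar> * \<sigma> x) {x<..<x + h}"
    define Y where "Y = weight_of \<sigma> {x<..<x + h}"
    have X: "0 < X" "X < top" using False fin_f by (simp_all add: X_def zero_less_iff_neq_zero)
    have "Y \<noteq> 0"
    proof
      assume "Y = 0"
      then have "{x<..<x + h} \<in> null_sets (integral_measure \<sigma>)"
        by (simp add: Y_def weight_of_eq_emeasure[OF \<sigma>] null_sets_def)
      then have "X = 0"
        unfolding X_def by (subst weight_of_mult_eq(2)[OF \<sigma> f]) (auto intro: nn_integral_null_set)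
      with X show False by simp
    qed
    moreover have "Y < top" using fin by (simp add: Y_def)
    ultimately obtain y where y: "Y = ennreal y" "0 < y"
      by (cases Y rule: ennreal_cases) auto
    have "0 < X / Y" "X / Y < top"
      using X y by (simp_all add: ennreal_zero_less_divide ennreal_divide_eq_top_iff less_top[symmetric])
    then obtain l where l: "ennreal (2 powr real_of_int l) < X / Y" "X / Y
        \<le> ennreal (2 powr (real_of_int l + 1))"
      by (rule dyadic_level)
    let ?U = "average_superlevel \<sigma> f (2 powr real_of_int l)"
    have lt: "ennreal (2 powr real_of_int l) * Y < X"
      using l(1) y by (simp add: ennreal_less_divide_iff)
    obtain a where a: "a < x" "{a<..<x + h} \<subseteq> ?U"
    proof (rule Ioo_subset_average_superlevel[OF \<sigma> fin f _ \<open>0 < h\<close>])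
      show "0 < (2::real) powr real_of_int l" by simp
    qed (use lt that in \<open>simp_all add: X_def Y_def\<close>)
    define L where "L = connected_component_set ?U x"
    have x: "x \<in> {a<..<x + h}" using a \<open>0 < h\<close> by simp
    then have "x \<in> ?U" using a by blast
    then have L_comp: "L \<in> components ?U" unfolding L_def by (rule componentsI)
    have sub: "{a<..<x + h} \<subseteq> L" unfolding L_def
      using x a by (intro connected_component_maximal) auto
    have "open L" unfolding L_def by (intro open_connected_component open_average_superlevel)
    then have L_meas [measurable]: "L \<in> sets lebesgue" by (intro sets_completionI_sets) simp
    have gL: "(\<lambda>y. \<sigma> y * indicator L y) \<in> borel_measurable lebesgue" by measurable
    let ?M = "maximal_plus (\<lambda>y. \<sigma> y * indicator L y) x"
    have "Y = emeasure (integral_measure \<sigma>) {x<..<x + h}"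
      unfolding Y_def by (rule weight_of_eq_emeasure[OF \<sigma>]) simp
    also have "{x<..<x + h} = {x<..<x + h} \<inter> L" using sub a by auto
    also have "emeasure (integral_measure \<sigma>) ({x<..<x + h} \<inter> L) = emeasure (integral_measure (\<lambda>y. \<sigma> y
        * indicator L y)) {x<..<x + h}"
      by (rule emeasure_integral_measure_restrict[symmetric]) auto
    also have "\<dots> \<le> ?M * ennreal h" by (rule maximal_plus_ge[OF gL \<open>0 < h\<close>])
    finally have Y_le: "Y \<le> ?M * ennreal h" .
    have "X = X / Y * Y" using y by (simp add: ennreal_divide_mult_cancel)
    also have "\<dots> \<le> ennreal (2 powr (real_of_int l + 1)) * (?M * ennreal h)"
      by (intro mult_mono l Y_le) auto
    finally have "X / ennreal h \<le> ennreal (2 powr (real_of_int l + 1)) * (?M * ennreal h) / ennreal h"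
      by (rule divide_right_mono_ennreal)
    also have "\<dots> = ennreal (2 powr (real_of_int l + 1)) * ?M"
      using \<open>0 < h\<close> by (simp add: ennreal_mult_divide_eq flip: mult.assoc)
    finally have "ennpowr (X / ennreal h) p \<le> ennpowr (ennreal (2 powr (real_of_int l + 1)) * ?M) p"
      using p by (intro ennpowr_mono) auto
    also have "\<dots> = ennreal (2 powr ((real_of_int l + 1) * p)) * (indicator L x * ennpowr ?M p)"
      using p subsetD[OF sub x] by (simp add: ennpowr_mult ennpowr_ennreal powr_powr)
    also have "\<dots> \<le> ennreal (2 powr ((real_of_int l + 1) * p)) *
       (\<integral>\<^sup>+L. indicator L x * ennpowr (maximal_plus (\<lambda>y. \<sigma> y * indicator L y) x) p
           \<partial>count_space (components ?U))"
      by (intro mult_left_mono nn_integral_count_space_ge L_comp) simp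
    also have "\<dots> \<le> ?R" by (rule nn_integral_count_space_ge) simp
    finally show ?thesis unfolding X_def .
  qed simp
  moreover have "maximal_plus (\<lambda>y. f y * \<sigma> y) x = (SUP h\<in>{0<..}. weight_of (\<lambda>x. \<bar>f x\<bar> * \<sigma> x) {x<..<x
      + h} / ennreal h)"
    by (subst maximal_plus_eq) (simp_all add: weight_of_mult_eq(1)[OF \<sigma> f])
  ultimately show ?thesis using p by (simp add: ennpowr_SUP_le_iff)
qed

lemma mult_double_powr_eq_ennpowr:
  assumes "1 < p"
  shows "ennreal \<bar>y\<bar> * ennreal ((2 * \<bar>y\<bar>) powr (p - 1)) = ennreal (2 powr (p - 1)) * ennpowr (ennreal \<bar>y\<bar>) p"
proof (cases "y = 0")
  case False
  have "\<bar>y\<bar> * (2 * \<bar>y\<bar>) powr (p - 1) = 2 powr (p - 1) * (\<bar>y\<bar> powr 1 * \<bar>y\<bar> powr (p - 1))"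
    by (subst powr_mult) auto
  also have "\<bar>y\<bar> powr 1 * \<bar>y\<bar> powr (p - 1) = \<bar>y\<bar> powr p" by (subst powr_add[symmetric]) simp
  finally show ?thesis by (simp add: ennpowr_ennreal flip: ennreal_mult)
qed simp

text \<open>
  The factor \<open>2\<^sup>p\<close> comes from the width of the dyadic levels, 4 from the weak type bound, and the
  rest from the geometric series applied to \<open>t = 2 |f|\<close> with exponent \<open>p - 1\<close>.
\<close>

definition strong_type_const :: "real \<Rightarrow> real" where
  "strong_type_const p = 2 powr p * (4 * (2 powr (p - 1) / (1 - 2 powr (- (p - 1)))))"

text \<open>
  A one-sided Sawyer theorem. After the pointwise bound is integrated, testing applies to every
  component separately; the components of one \<open>U l\<close> are disjoint, so their \<open>\<sigma>\<close>-masses add up to that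
  of \<open>U l\<close>. Exchanging the sum over \<open>l\<close> with the integral that bounds \<open>\<sigma>(U l)\<close> leaves a geometric series
  at each point.
\<close>

lemma testing_imp_strong_type:
  assumes p: "1 < p" and w: "weight w" and \<sigma>: "weight \<sigma>"
    and fin: "\<And>a b. weight_of \<sigma> {a<..<b} < top"
    and test: "\<And>I. is_interval I \<Longrightarrow> bounded I \<Longrightarrow>
      (\<integral>\<^sup>+x\<in>I. ennpowr (maximal_plus (\<lambda>y. \<sigma> y * indicator I y) x) p * ennreal (w x) \<partial>lebesgue)
        \<le> K * weight_of \<sigma> I"
    and f [measurable]: "f \<in> borel_measurable lebesgue"
    and fin_p: "(\<integral>\<^sup>+x. ennpowr (ennreal \<bar>f x\<bar>) p \<partial>integral_measure \<sigma>) < top"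
  shows "(\<integral>\<^sup>+x. ennpowr (maximal_plus (\<lambda>y. f y * \<sigma> y) x) p * ennreal (w x) \<partial>lebesgue)
    \<le> ennreal (strong_type_const p) * K * (\<integral>\<^sup>+x. ennpowr (ennreal \<bar>f x\<bar>) p \<partial>integral_measure \<sigma>)"
proof -
  let ?S = "integral_measure \<sigma>"
  have \<sigma>_meas [measurable]: "\<sigma> \<in> borel_measurable lebesgue" and w_meas [measurable]: "w \<in> borel_measurable lebesgue"
    using \<sigma> w by (auto simp: weight_def)
  \<comment> \<open>Local integrability of \<open>f \<sigma>\<close>, from \<open>|f| \<le> 1 + |f|\<^sup>p\<close>.\<close>
  have fin_f: "weight_of (\<lambda>x. \<bar>f x\<bar> * \<sigma> x) {a<..<b} < top" for a b
  proof -
    have "weight_of (\<lambda>x. \<bar>f x\<bar> * \<sigma> x) {a<..<b} = (\<integral>\<^sup>+x\<in>{a<..<b}. ennreal \<bar>f x\<bar> \<partial>?S)"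
      by (rule weight_of_mult_eq(2)[OF \<sigma> f]) simp
    also have "\<dots> \<le> (\<integral>\<^sup>+x. indicator {a<..<b} x + ennpowr (ennreal \<bar>f x\<bar>) p \<partial>?S)"
    proof (rule nn_integral_mono)
      fix x
      have "ennreal \<bar>f x\<bar> \<le> ennpowr (ennreal \<bar>f x\<bar>) p" if "1 \<le> \<bar>f x\<bar>"
        using that p powr_mono[of 1 p "\<bar>f x\<bar>"] by (simp add: ennpowr_ennreal ennreal_leI)
      moreover have "ennreal \<bar>f x\<bar> \<le> 1" if "\<not> 1 \<le> \<bar>f x\<bar>"
        using that by (simp add: ennreal_le_1)
      ultimately show "ennreal \<bar>f x\<bar> * indicator {a<..<b} x \<le> indicator {a<..<b} x + ennpowr (ennreal \<bar>f x\<bar>) p"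
        by (cases "1 \<le> \<bar>f x\<bar>"; cases "x \<in> {a<..<b}") (auto intro: add_increasing add_increasing2)
    qed
    also have "\<dots> = weight_of \<sigma> {a<..<b} + (\<integral>\<^sup>+x. ennpowr (ennreal \<bar>f x\<bar>) p \<partial>?S)"
      by (subst nn_integral_add) (simp_all add: weight_of_eq_emeasure[OF \<sigma>])
    also have "\<dots> < top" using fin fin_p by simp
    finally show ?thesis .
  qed
  define U where "U l = average_superlevel \<sigma> f (2 powr real_of_int l)" for l :: int
  define c where "c l = ennreal (2 powr ((real_of_int l + 1) * p))" for l :: int
  define M where "M L = maximal_plus (\<lambda>y. \<sigma> y * indicator L y)" for L
  have opU: "open (U l)" for l unfolding U_def by (rule open_average_superlevel)
  have comp: "open L \<and> is_interval L" if "L \<in> components (U l)" for L l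
    using that opU open_components[of "U l" L] in_components_connected[of L "U l"]
    by (simp add: is_interval_connected_1)
  have comp_meas: "L \<in> sets lebesgue" if "L \<in> components (U l)" for L l
    using comp[OF that] by (intro sets_completionI_sets) simp
  have countable_comp: "countable (components (U l))" for l
    using opU pairwise_disjoint_components[of "U l"]
    by (intro countable_disjoint_open_subsets) (auto intro: open_components simp: disjnt_def pairwise_def)
  have M_meas: "M L \<in> borel_measurable lebesgue" if "L \<in> components (U l)" for L l
  proof -
    have "(\<lambda>y. \<sigma> y * indicator L y) \<in> borel_measurable lebesgue" using comp_meas[OF that] by measurable
    then show ?thesis unfolding M_def using maximal_plus_measurable by (auto simp: measurable_completion)
  qed
  have term_meas: "(\<lambda>x. indicator L x * ennpowr (M L x) p * ennreal (w x)) \<in> borel_measurable lebesgue"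
    if "L \<in> components (U l)" for L l
    using comp_meas[OF that] M_meas[OF that] by measurable
  have sum_L: "(\<integral>\<^sup>+x. (\<integral>\<^sup>+L. indicator L x * ennpowr (M L x) p * ennreal (w x)
      \<partial>count_space (components (U l))) \<partial>lebesgue)
    \<le> K * weight_of \<sigma> (U l)" for l
  proof -
    have "(\<integral>\<^sup>+x. (\<integral>\<^sup>+L. indicator L x * ennpowr (M L x) p * ennreal (w x)
        \<partial>count_space (components (U l))) \<partial>lebesgue)
      = (\<integral>\<^sup>+L. (\<integral>\<^sup>+x. indicator L x * ennpowr (M L x) p * ennreal (w x) \<partial>lebesgue)
          \<partial>count_space (components (U l)))"
      by (rule nn_integral_count_space_nn_integral[OF countable_comp term_meas])
    also have "\<dots> \<le> (\<integral>\<^sup>+L. K * emeasure ?S L \<partial>count_space (components (U l)))"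
    proof (rule nn_integral_mono)
      fix L assume "L \<in> space (count_space (components (U l)))"
      then have L: "L \<in> components (U l)" by simp
      have "(\<integral>\<^sup>+x. indicator L x * ennpowr (M L x) p * ennreal (w x) \<partial>lebesgue)
        = (\<integral>\<^sup>+x\<in>L. ennpowr (M L x) p * ennreal (w x) \<partial>lebesgue)"
        by (intro nn_integral_cong) (simp only: mult_ac)
      also have "\<dots> \<le> K * weight_of \<sigma> L"
        unfolding M_def using comp[OF L] by (intro testing_interval[OF p w \<sigma> test]) auto
      also have "weight_of \<sigma> L = emeasure ?S L" by (rule weight_of_eq_emeasure[OF \<sigma> comp_meas[OF L]])
      finally show "(\<integral>\<^sup>+x. indicator L x * ennpowr (M L x) p * ennreal (w x) \<partial>lebesgue) \<le> K * emeasure ?S L" .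
    qed
    also have "\<dots> = K * (\<integral>\<^sup>+L. emeasure ?S L \<partial>count_space (components (U l)))"
      by (rule nn_integral_cmult) simp
    also have "(\<integral>\<^sup>+L. emeasure ?S L \<partial>count_space (components (U l))) = emeasure ?S (\<Union>L\<in>components (U l). L)"
      using pairwise_disjoint_components[of "U l"] comp_meas countable_comp
      by (intro emeasure_UN_countable[symmetric]) (auto simp: disjoint_family_on_def pairwise_def)
    also have "(\<Union>L\<in>components (U l). L) = U l" by (simp add: Union_components[symmetric])
    also have "emeasure ?S (U l) = weight_of \<sigma> (U l)"
      using opU by (intro weight_of_eq_emeasure[OF \<sigma>, symmetric] sets_completionI_sets) simp
    finally show ?thesis .
  qed
  have inner_meas: "(\<lambda>x. \<integral>\<^sup>+L. indicator L x * ennpowr (M L x) p * ennreal (w x)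
      \<partial>count_space (components (U l))) \<in> borel_measurable lebesgue" for l
    using countable_comp term_meas by (intro borel_measurable_nn_integral_count_space) auto
  have level: "c l * weight_of \<sigma> (U l) \<le> ennreal (2 powr p * 4) *
      (\<integral>\<^sup>+x. ennreal \<bar>f x\<bar> * (ennreal (2 powr (real_of_int l * (p - 1)))
          * of_bool (2 powr real_of_int l < 2 * \<bar>f x\<bar>)) \<partial>?S)" for l
  proof -
    have "(2::real) powr ((real_of_int l + 1) * p) = 2 powr (p + real_of_int l * (p - 1) + real_of_int l)"
      by (simp add: algebra_simps)
    then have c: "c l = ennreal (2 powr p) * ennreal (2 powr (real_of_int l * (p - 1)))
        * ennreal (2 powr real_of_int l)"
      by (simp add: c_def powr_add ennreal_mult)
    have "c l * weight_of \<sigma> (U l) = ennreal (2 powr p) * (ennreal (2 powr (real_of_int l * (p - 1)))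
        * (ennreal (2 powr real_of_int l) * weight_of \<sigma> (U l)))"
      unfolding c by (simp only: mult.assoc)
    also have "\<dots> \<le> ennreal (2 powr p) * (ennreal (2 powr (real_of_int l * (p - 1))) *
        (4 * (\<integral>\<^sup>+x. ennreal \<bar>f x\<bar> * of_bool (2 powr real_of_int l < 2 * \<bar>f x\<bar>) \<partial>?S)))"
      unfolding U_def by (intro mult_left_mono weight_of_average_superlevel_le[OF \<sigma> fin f]) simp_all
    also have "\<dots> = ennreal (2 powr p) * 4 * (ennreal (2 powr (real_of_int l * (p - 1))) *
        (\<integral>\<^sup>+x. ennreal \<bar>f x\<bar> * of_bool (2 powr real_of_int l < 2 * \<bar>f x\<bar>) \<partial>?S))"
      by (simp only: mult_ac)
    also have "ennreal (2 powr (real_of_int l * (p - 1))) *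
        (\<integral>\<^sup>+x. ennreal \<bar>f x\<bar> * of_bool (2 powr real_of_int l < 2 * \<bar>f x\<bar>) \<partial>?S)
      = (\<integral>\<^sup>+x. ennreal (2 powr (real_of_int l * (p - 1))) * (ennreal \<bar>f x\<bar>
          * of_bool (2 powr real_of_int l < 2 * \<bar>f x\<bar>)) \<partial>?S)"
      by (rule nn_integral_cmult[symmetric]) measurable
    also have "\<dots> = (\<integral>\<^sup>+x. ennreal \<bar>f x\<bar> * (ennreal (2 powr (real_of_int l * (p - 1)))
        * of_bool (2 powr real_of_int l < 2 * \<bar>f x\<bar>)) \<partial>?S)"
      by (simp only: mult_ac)
    also have "ennreal (2 powr p) * 4 = ennreal (2 powr p * 4)" by (simp add: ennreal_mult)
    finally show ?thesis .
  qed
  define d where "d = 1 / (1 - (2::real) powr (- (p - 1)))"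
  have d: "0 \<le> d" unfolding d_def using p powr_less_one[of 2 "- (p - 1)"] by simp
  have "(\<integral>\<^sup>+x. ennpowr (maximal_plus (\<lambda>y. f y * \<sigma> y) x) p * ennreal (w x) \<partial>lebesgue)
    \<le> (\<integral>\<^sup>+x. \<integral>\<^sup>+l. c l * (\<integral>\<^sup>+L. indicator L x * ennpowr (M L x) p * ennreal (w x)
    \<partial>count_space (components (U l))) \<partial>count_space UNIV \<partial>lebesgue)"
  proof (rule nn_integral_mono)
    fix x
    have "ennpowr (maximal_plus (\<lambda>y. f y * \<sigma> y) x) p * ennreal (w x)
      \<le> (\<integral>\<^sup>+l. c l * (\<integral>\<^sup>+L. indicator L x * ennpowr (M L x) p \<partial>count_space (components (U l)))
      \<partial>count_space UNIV) * ennreal (w x)"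
      unfolding c_def M_def U_def
          by (intro mult_right_mono maximal_plus_pointwise_dyadic[OF p \<sigma> fin f fin_f]) simp
    also have "\<dots> = (\<integral>\<^sup>+l. c l * (\<integral>\<^sup>+L. indicator L x * ennpowr (M L x) p * ennreal (w x)
        \<partial>count_space (components (U l))) \<partial>count_space UNIV)"
      by (simp add: nn_integral_multc mult.assoc flip: nn_integral_multc)
    finally show "ennpowr (maximal_plus (\<lambda>y. f y * \<sigma> y) x) p * ennreal (w x)
      \<le> (\<integral>\<^sup>+l. c l * (\<integral>\<^sup>+L. indicator L x * ennpowr (M L x) p * ennreal (w x)
      \<partial>count_space (components (U l))) \<partial>count_space UNIV)" .
  qed
  also have "\<dots> = (\<integral>\<^sup>+l. \<integral>\<^sup>+x. c l * (\<integral>\<^sup>+L. indicator L x * ennpowr (M L x) p * ennreal (w x)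
      \<partial>count_space (components (U l))) \<partial>lebesgue \<partial>count_space UNIV)"
    using inner_meas by (intro nn_integral_count_space_nn_integral) auto
  also have "\<dots> = (\<integral>\<^sup>+l. c l * (\<integral>\<^sup>+x. (\<integral>\<^sup>+L. indicator L x * ennpowr (M L x) p * ennreal (w x)
      \<partial>count_space (components (U l))) \<partial>lebesgue) \<partial>count_space UNIV)"
    by (intro nn_integral_cong nn_integral_cmult inner_meas)
  also have "\<dots> \<le> (\<integral>\<^sup>+l. c l * (K * weight_of \<sigma> (U l)) \<partial>count_space UNIV)"
    by (intro nn_integral_mono mult_left_mono sum_L) simp
  also have "\<dots> = (\<integral>\<^sup>+l. K * (c l * weight_of \<sigma> (U l)) \<partial>count_space UNIV)"
    by (simp only: mult_ac)
  also have "\<dots> = K * (\<integral>\<^sup>+l. c l * weight_of \<sigma> (U l) \<partial>count_space UNIV)"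
    by (rule nn_integral_cmult) simp
  also have "(\<integral>\<^sup>+l. c l * weight_of \<sigma> (U l) \<partial>count_space UNIV)
    \<le> (\<integral>\<^sup>+l. ennreal (2 powr p * 4) * (\<integral>\<^sup>+x. ennreal \<bar>f x\<bar> * (ennreal (2 powr (real_of_int l * (p - 1)))
    * of_bool (2 powr real_of_int l < 2 * \<bar>f x\<bar>)) \<partial>?S) \<partial>count_space UNIV)"
    by (intro nn_integral_mono level)
  also have "\<dots> = ennreal (2 powr p * 4) * (\<integral>\<^sup>+l. (\<integral>\<^sup>+x. ennreal \<bar>f x\<bar> * (ennreal (2 powr (real_of_int l
      * (p - 1))) * of_bool (2 powr real_of_int l < 2 * \<bar>f x\<bar>)) \<partial>?S) \<partial>count_space UNIV)"
    by (rule nn_integral_cmult) simp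
  also have "(\<integral>\<^sup>+l. (\<integral>\<^sup>+x. ennreal \<bar>f x\<bar> * (ennreal (2 powr (real_of_int l * (p - 1)))
      * of_bool (2 powr real_of_int l < 2 * \<bar>f x\<bar>)) \<partial>?S) \<partial>count_space UNIV)
    = (\<integral>\<^sup>+x. (\<integral>\<^sup>+l. ennreal \<bar>f x\<bar> * (ennreal (2 powr (real_of_int l * (p - 1)))
        * of_bool (2 powr real_of_int l < 2 * \<bar>f x\<bar>)) \<partial>count_space UNIV) \<partial>?S)"
    by (rule nn_integral_count_space_nn_integral[symmetric]) simp_all
  also have "\<dots> \<le> (\<integral>\<^sup>+x. ennreal (2 powr (p - 1) * d) * ennpowr (ennreal \<bar>f x\<bar>) p \<partial>?S)"
  proof (rule nn_integral_mono)
    fix x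
    have "(\<integral>\<^sup>+l. ennreal \<bar>f x\<bar> * (ennreal (2 powr (real_of_int l * (p - 1)))
        * of_bool (2 powr real_of_int l < 2 * \<bar>f x\<bar>)) \<partial>count_space UNIV)
      = ennreal \<bar>f x\<bar> * (\<integral>\<^sup>+l. ennreal (2 powr (real_of_int l * (p - 1)))
          * of_bool (2 powr real_of_int l < 2 * \<bar>f x\<bar>) \<partial>count_space UNIV)"
      by (rule nn_integral_cmult) simp
    also have "\<dots> \<le> ennreal \<bar>f x\<bar> * ennreal ((2 * \<bar>f x\<bar>) powr (p - 1) / (1 - 2 powr (- (p - 1))))"
      using p by (intro mult_left_mono dyadic_geometric_sum) auto
    also have "(2 * \<bar>f x\<bar>) powr (p - 1) / (1 - 2 powr (- (p - 1))) = (2 * \<bar>f x\<bar>) powr (p - 1) * d"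
      by (simp add: d_def)
    also have "ennreal ((2 * \<bar>f x\<bar>) powr (p - 1) * d) = ennreal ((2 * \<bar>f x\<bar>) powr (p - 1)) * ennreal d"
      by (intro ennreal_mult d) simp
    also have "ennreal \<bar>f x\<bar> * (ennreal ((2 * \<bar>f x\<bar>) powr (p - 1)) * ennreal d)
      = (ennreal (2 powr (p - 1)) * ennpowr (ennreal \<bar>f x\<bar>) p) * ennreal d"
      unfolding mult_double_powr_eq_ennpowr[OF p, symmetric] by (simp only: mult.assoc)
    also have "\<dots> = ennreal (2 powr (p - 1) * d) * ennpowr (ennreal \<bar>f x\<bar>) p"
      by (subst ennreal_mult[OF _ d]) (simp_all add: mult_ac)
    finally show "(\<integral>\<^sup>+l. ennreal \<bar>f x\<bar> * (ennreal (2 powr (real_of_int l * (p - 1)))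
        * of_bool (2 powr real_of_int l < 2 * \<bar>f x\<bar>)) \<partial>count_space UNIV)
      \<le> ennreal (2 powr (p - 1) * d) * ennpowr (ennreal \<bar>f x\<bar>) p" .
  qed
  also have "\<dots> = ennreal (2 powr (p - 1) * d) * (\<integral>\<^sup>+x. ennpowr (ennreal \<bar>f x\<bar>) p \<partial>?S)"
    by (rule nn_integral_cmult) simp
  finally have "(\<integral>\<^sup>+x. ennpowr (maximal_plus (\<lambda>y. f y * \<sigma> y) x) p * ennreal (w x) \<partial>lebesgue)
    \<le> K * (ennreal (2 powr p * 4) * (ennreal (2 powr (p - 1) * d) * (\<integral>\<^sup>+x. ennpowr (ennreal \<bar>f x\<bar>) p \<partial>?S)))"
    by (simp add: mult_left_mono)
  also have "\<dots> = (ennreal (2 powr p * 4) * ennreal (2 powr (p - 1) * d)) * K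
      * (\<integral>\<^sup>+x. ennpowr (ennreal \<bar>f x\<bar>) p \<partial>?S)"
    by (simp only: mult_ac)
  also have "ennreal (2 powr p * 4) * ennreal (2 powr (p - 1) * d) = ennreal (strong_type_const p)"
    using d by (subst ennreal_mult[symmetric]) (auto simp: strong_type_const_def d_def)
  finally show ?thesis .
qed

section \<open>The two-weight inequality\<close>

lemma W_minus_const_finite:
  assumes p: "1 < p" and fin: "W_minus_const p \<sigma> \<Psi> \<noteq> top" and I: "is_interval I" "bounded I"
  shows "weight_of \<sigma> I \<noteq> top"
    and "(\<integral>\<^sup>+x\<in>I. ennpowr (maximal_young_plus \<Psi> (\<lambda>y. \<sigma> y powr (1 / p) * indicator I y) x) p \<partial>lebesgue)
      \<le> W_minus_const p \<sigma> \<Psi> * weight_of \<sigma> I"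
proof -
  let ?X = "\<integral>\<^sup>+x\<in>I. ennpowr (maximal_young_plus \<Psi> (\<lambda>y. \<sigma> y powr (1 / p) * indicator I y) x) p \<partial>lebesgue"
  have le: "(if weight_of \<sigma> I = \<infinity> then \<infinity> else ?X / weight_of \<sigma> I) \<le> W_minus_const p \<sigma> \<Psi>"
    unfolding W_minus_const_def using I by (intro SUP_upper) simp
  show "weight_of \<sigma> I \<noteq> top"
  proof
    assume "weight_of \<sigma> I = top"
    with le fin show False by (simp add: top_unique)
  qed
  then have div: "?X / weight_of \<sigma> I \<le> W_minus_const p \<sigma> \<Psi>" using le by simp
  obtain s where s: "weight_of \<sigma> I = ennreal s" "0 \<le> s"
    using \<open>weight_of \<sigma> I \<noteq> top\<close> by (cases "weight_of \<sigma> I" rule: ennreal_cases) auto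
  show "?X \<le> W_minus_const p \<sigma> \<Psi> * weight_of \<sigma> I"
  proof (cases "s = 0")
    case True
    \<comment> \<open>A positive numerator over the denominator 0 would make the constant infinite.\<close>
    have "?X = 0"
    proof (rule ccontr)
      assume "?X \<noteq> 0"
      then have "?X / weight_of \<sigma> I = top" using True s by (simp add: ennreal_divide_eq_top_iff)
      with div fin show False by (simp add: top_unique)
    qed
    then show ?thesis by simp
  next
    case False
    then have "?X = ?X / weight_of \<sigma> I * weight_of \<sigma> I"
      using s by (simp add: ennreal_divide_mult_cancel)
    also have "\<dots> \<le> W_minus_const p \<sigma> \<Psi> * weight_of \<sigma> I" by (intro mult_right_mono div) simp
    finally show ?thesis .
  qed
qed

text \<open>
  If \<open>M\<^sup>+(f \<sigma>)\<close> is positive at \<open>x\<close>, it is positive at some \<open>b > x\<close>, so \<open>\<sigma>\<close> does not vanish to the right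
  of \<open>b\<close>. A vanishing constant then forces \<open>w\<close> to vanish on an interval around \<open>x\<close>, and by the
  covering inequality with \<open>\<nu> = 0\<close> these intervals together are null for \<open>w\<close>.
\<close>

lemma A_plus_const_eq_0_imp:
  assumes \<Phi>: "young_function \<Phi>" and s: "0 < s" "0 < \<Phi> s"
    and p: "1 < p" and w: "weight w" and \<sigma>: "weight \<sigma>" and f [measurable]: "f \<in> borel_measurable lebesgue"
    and A: "A_plus_const p w \<sigma> \<Phi> = 0"
  shows "(\<integral>\<^sup>+x. ennpowr (maximal_plus (\<lambda>y. f y * \<sigma> y) x) p * ennreal (w x) \<partial>lebesgue) = 0"
proof -
  have [measurable]: "\<sigma> \<in> borel_measurable lebesgue" "w \<in> borel_measurable lebesgue"
    and w_nn: "\<And>x. 0 \<le> w x" and \<sigma>_nn: "\<And>x. 0 \<le> \<sigma> x" using \<sigma> w by (auto simp: weight_def)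
  define g where "g = (\<lambda>y. f y * \<sigma> y)"
  have g [measurable]: "g \<in> borel_measurable lebesgue" unfolding g_def by measurable
  define N where "N = {x. 0 < maximal_plus g x}"
  have "open N" using open_maximal_plus_gt[OF g, of 0] by (simp add: N_def)
  then have N [measurable]: "N \<in> sets lebesgue" by (intro sets_completionI_sets) simp
  define F where "F = {(a, b). weight_of w {a<..<b} = 0}"
  have "N \<subseteq> (\<Union>(a, b)\<in>F. {a<..<b})"
  proof
    fix x assume "x \<in> N"
    then obtain e where e: "0 < e" "ball x e \<subseteq> N" using \<open>open N\<close> openE by blast
    \<comment> \<open>The points \<open>x - 1 < b < b + h\<close> will be the three points in the \<open>A\<^sub>p\<^sup>+\<close> condition.\<close>
    define b where "b = x + e / 2"
    have "b \<in> N" using e by (intro subsetD[OF e(2)]) (simp add: b_def dist_real_def)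
    then obtain h where h: "0 < h" "0 < emeasure (integral_measure g) {b<..<b + h}"
      unfolding N_def using maximal_plus_gt_iff[OF g, of 0 b] by auto
    let ?r = "\<lambda>y. \<sigma> y powr (1 / conj_exp p) * indicator {b<..<b + h} y"
    have ab: "x - 1 < b" using e by (simp add: b_def)
    have "luxemburg \<Phi> ?r {x - 1<..<b + h} \<noteq> 0"
    proof
      assume "luxemburg \<Phi> ?r {x - 1<..<b + h} = 0"
      then have "AE y in lebesgue. y \<in> {x - 1<..<b + h} \<longrightarrow> ?r y = 0"
        using ab h by (intro luxemburg_eq_0_imp[OF \<Phi> s]) auto
      then have "AE y in lebesgue. ennreal \<bar>g y\<bar> * indicator {b<..<b + h} y = 0"
      proof eventually_elim
        fix y assume *: "y \<in> {x - 1<..<b + h} \<longrightarrow> ?r y = 0"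
        show "ennreal \<bar>g y\<bar> * indicator {b<..<b + h} y = 0"
        proof (cases "y \<in> {b<..<b + h}")
          case True
          then have "\<sigma> y = 0" using * ab by simp
          then show ?thesis by (simp add: g_def)
        qed simp
      qed
      then have "(\<integral>\<^sup>+y. ennreal \<bar>g y\<bar> * indicator {b<..<b + h} y \<partial>lebesgue) = (\<integral>\<^sup>+y. 0
          \<partial>(lebesgue :: real measure))"
        by (rule nn_integral_cong_AE)
      then have "emeasure (integral_measure g) {b<..<b + h} = 0"
        by (simp add: emeasure_integral_measure g)
      with h show False by simp
    qed
    moreover have "weight_of w {x - 1<..<b} / ennreal (b + h - (x - 1)) *
      ennpowr (luxemburg \<Phi> ?r {x - 1<..<b + h}) p \<le> A_plus_const p w \<sigma> \<Phi>"
      unfolding A_plus_const_def using ab h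
      by (intro SUP_upper2[where i = "(x - 1, b, b + h)"]) auto
    ultimately have "weight_of w {x - 1<..<b} / ennreal (b + h - (x - 1)) = 0"
      using p by (simp add: A ennpowr_eq_0_iff)
    then have "weight_of w {x - 1<..<b} = 0" by (simp add: ennreal_divide_eq_0_iff)
    then have "(x - 1, b) \<in> F" by (simp add: F_def)
    then show "x \<in> (\<Union>(a, b)\<in>F. {a<..<b})" using e by (intro UN_I[of "(x - 1, b)"]) (simp_all add: b_def)
  qed
  moreover have op: "open (\<Union>(a, b)\<in>F. {a<..<b})" by (intro open_UN ballI) (simp add: case_prod_beta)
  ultimately have "emeasure (integral_measure w) N \<le> emeasure (integral_measure w) (\<Union>(a, b)\<in>F. {a<..<b})"
    by (intro emeasure_mono) simp_all
  also have "\<dots> \<le> 2 * emeasure (integral_measure (\<lambda>_. 0)) UNIV"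
    by (rule emeasure_Union_Ioo_le) (simp_all add: F_def weight_of_eq_emeasure[OF w])
  also have "\<dots> = 0" by (simp add: emeasure_integral_measure)
  finally have "(\<integral>\<^sup>+x. ennreal (w x) * indicator N x \<partial>lebesgue) = 0"
    using w_nn by (simp add: emeasure_integral_measure)
  moreover have "(\<lambda>x. ennreal (w x) * indicator N x) \<in> borel_measurable lebesgue" by measurable
  ultimately have "AE x in lebesgue. ennreal (w x) * indicator N x = 0"
    by (simp only: nn_integral_0_iff_AE)
  then have "AE x in lebesgue. ennpowr (maximal_plus g x) p * ennreal (w x) = 0"
  proof eventually_elim
    fix x assume "ennreal (w x) * indicator N x = 0"
    then show "ennpowr (maximal_plus g x) p * ennreal (w x) = 0"
      by (cases "x \<in> N") (auto simp: N_def)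
  qed
  then have "(\<integral>\<^sup>+x. ennpowr (maximal_plus g x) p * ennreal (w x) \<partial>lebesgue) = (\<integral>\<^sup>+x. 0
      \<partial>(lebesgue :: real measure))"
    by (rule nn_integral_cong_AE)
  then show ?thesis by (simp add: g_def)
qed

lemma maximal_plus_two_weight:
  fixes p \<kappa> :: real
  assumes \<Phi>: "young_function \<Phi>" and \<Psi>: "young_function \<Psi>" and \<kappa>: "0 < \<kappa>"
    and inv: "\<And>t. 0 < t \<Longrightarrow> gen_inverse \<Phi> t * gen_inverse \<Psi> t \<le> ennreal (\<kappa> * t)"
    and p: "1 < p" and w: "weight w" and \<sigma>: "weight \<sigma>" and f [measurable]: "f \<in> borel_measurable lebesgue"
    and fin_p: "(\<integral>\<^sup>+x. ennpowr (ennreal \<bar>f x\<bar>) p * ennreal (\<sigma> x) \<partial>lebesgue) < top"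
  shows "(\<integral>\<^sup>+x. ennpowr (maximal_plus (\<lambda>y. f y * \<sigma> y) x) p * ennreal (w x) \<partial>lebesgue)
    \<le> ennreal (strong_type_const p * (140 * (10 * \<kappa>) powr p)) *
        (W_minus_const p \<sigma> \<Psi> * A_plus_const p w \<sigma> \<Phi>) *
        (\<integral>\<^sup>+x. ennpowr (ennreal \<bar>f x\<bar>) p * ennreal (\<sigma> x) \<partial>lebesgue)"
proof -
  let ?W = "W_minus_const p \<sigma> \<Psi>" and ?A = "A_plus_const p w \<sigma> \<Phi>"
  let ?F = "\<integral>\<^sup>+x. ennpowr (ennreal \<bar>f x\<bar>) p * ennreal (\<sigma> x) \<partial>lebesgue"
  let ?X = "\<integral>\<^sup>+x. ennpowr (maximal_plus (\<lambda>y. f y * \<sigma> y) x) p * ennreal (w x) \<partial>lebesgue"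
  let ?c = "140 * (10 * \<kappa>) powr p"
  have \<sigma>_meas [measurable]: "\<sigma> \<in> borel_measurable lebesgue" and \<sigma>_nn: "\<And>x. 0 \<le> \<sigma> x"
    using \<sigma> by (auto simp: weight_def)
  have prod: "u * v \<le> \<kappa> * (\<Phi> u + \<Psi> v)" if "0 \<le> u" "0 \<le> v" for u v
    by (rule young_product_le[OF \<Phi> \<Psi> \<kappa> inv that])
  have c_pos: "0 < strong_type_const p"
    unfolding strong_type_const_def using p powr_less_one[of 2 "- (p - 1)"] by simp
  have F_eq: "(\<integral>\<^sup>+x. ennpowr (ennreal \<bar>f x\<bar>) p \<partial>integral_measure \<sigma>) = ?F"
    using \<sigma>_nn by (subst nn_integral_integral_measure) simp_all
  consider "?W \<noteq> top" | "?W = top" "?A = 0" | "?F = 0" | "?W = top" "?A \<noteq> 0" "?F \<noteq> 0" by blast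
  then show ?thesis
  proof cases
    case 1
    have test: "(\<integral>\<^sup>+x\<in>I. ennpowr (maximal_plus (\<lambda>y. \<sigma> y * indicator I y) x) p * ennreal (w x) \<partial>lebesgue)
        \<le> ennreal ?c * ?A * ?W * weight_of \<sigma> I" if I: "is_interval I" "bounded I" for I
    proof -
      note testing_bound[OF \<Phi> \<Psi> \<kappa> prod p w \<sigma> I(1) W_minus_const_finite(1)[OF p 1 I]]
      also have "ennreal ?c * ?A * (\<integral>\<^sup>+x\<in>I. ennpowr (maximal_young_plus \<Psi> (\<lambda>y. \<sigma> y powr (1 / p)
          * indicator I y) x) p \<partial>lebesgue)
        \<le> ennreal ?c * ?A * (?W * weight_of \<sigma> I)"
        by (intro mult_left_mono W_minus_const_finite(2)[OF p 1 I]) simp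
      finally show ?thesis by (simp only: mult.assoc)
    qed
    have fin: "weight_of \<sigma> {a<..<b} < top" for a b
      using W_minus_const_finite(1)[OF p 1, of "{a<..<b}"] by (simp add: is_interval_oo less_top)
    have "?X \<le> ennreal (strong_type_const p) * (ennreal ?c * ?A * ?W) * (\<integral>\<^sup>+x. ennpowr (ennreal \<bar>f x\<bar>) p
        \<partial>integral_measure \<sigma>)"
      using fin_p by (intro testing_imp_strong_type[OF p w \<sigma> fin test f]) (simp_all add: F_eq)
    also have "\<dots> = (ennreal (strong_type_const p) * ennreal ?c) * (?W * ?A) * ?F"
      unfolding F_eq by (simp only: mult_ac)
    also have "ennreal (strong_type_const p) * ennreal ?c = ennreal (strong_type_const p * ?c)"
      using c_pos by (intro ennreal_mult[symmetric]) simp_all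
    finally show ?thesis .
  next
    case 2
    obtain s where "0 < s" "0 < \<Phi> s" using young_product_imp_pos[OF \<Phi> \<kappa> prod] .
    then have "?X = 0" using 2 by (intro A_plus_const_eq_0_imp[OF \<Phi> _ _ p w \<sigma> f]) simp_all
    then show ?thesis by (simp only: zero_le)
  next
    case 3
    have "AE x in lebesgue. ennpowr (ennreal \<bar>f x\<bar>) p * ennreal (\<sigma> x) = 0"
    proof -
      have "(\<lambda>x. ennpowr (ennreal \<bar>f x\<bar>) p * ennreal (\<sigma> x)) \<in> borel_measurable lebesgue" by measurable
      with 3 show ?thesis by (simp only: nn_integral_0_iff_AE)
    qed
    then have "AE x in lebesgue. f x * \<sigma> x = 0"
    proof eventually_elim
      fix x assume "ennpowr (ennreal \<bar>f x\<bar>) p * ennreal (\<sigma> x) = 0"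
      then have "f x = 0 \<or> \<sigma> x \<le> 0" using p by (simp add: ennpowr_eq_0_iff ennreal_eq_0_iff)
      then show "f x * \<sigma> x = 0" using \<sigma>_nn[of x] by auto
    qed
    then have "maximal_plus (\<lambda>y. f y * \<sigma> y) x = 0" for x
      by (intro maximal_plus_eq_0) measurable
    then have "?X = 0" by simp
    then show ?thesis by (simp only: zero_le)
  next
    case 4
    have "0 < strong_type_const p * ?c" using c_pos \<kappa> by simp
    then have "ennreal (strong_type_const p * ?c) \<noteq> 0" by (simp only: ennreal_eq_0_iff not_le)
    with 4 show ?thesis by (simp add: ennreal_top_mult ennreal_mult_top)
  qed
qed

theorem theorem13:
  fixes p \<kappa> :: real
  assumes "p > 1" and "\<kappa> > 0"
  shows "\<exists>C>0. \<forall>\<Phi> \<Psi> w \<sigma> f.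
           young_function \<Phi> \<longrightarrow> young_function \<Psi> \<longrightarrow>
           (\<forall>t>0. gen_inverse \<Phi> t * gen_inverse \<Psi> t \<le> ennreal (\<kappa> * t)) \<longrightarrow>
           weight w \<longrightarrow> weight \<sigma> \<longrightarrow> in_Lp p \<sigma> f \<longrightarrow>
           Lp_norm p w (maximal_plus (\<lambda>x. f x * \<sigma> x))
             \<le> ennreal C * ennpowr (W_minus_const p \<sigma> \<Psi> * A_plus_const p w \<sigma> \<Phi>) (1 / p)
                 * Lp_norm p \<sigma> (\<lambda>x. ennreal \<bar>f x\<bar>)"
proof -
  define c where "c = strong_type_const p * (140 * (10 * \<kappa>) powr p)"
  have "0 < strong_type_const p"
    unfolding strong_type_const_def using assms(1) powr_less_one[of 2 "- (p - 1)"] by simp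
  then have c: "0 < c" using \<open>\<kappa> > 0\<close> by (simp add: c_def)
  show ?thesis
  proof (intro exI[of _ "c powr (1 / p)"] conjI allI impI)
    show "0 < c powr (1 / p)" using c by simp
  next
    fix \<Phi> \<Psi> w \<sigma> f
    assume \<Phi>: "young_function \<Phi>" and \<Psi>: "young_function \<Psi>"
      and inv: "\<forall>t>0. gen_inverse \<Phi> t * gen_inverse \<Psi> t \<le> ennreal (\<kappa> * t)"
      and w: "weight w" and \<sigma>: "weight \<sigma>" and f: "in_Lp p \<sigma> f"
    let ?F = "\<integral>\<^sup>+x. ennpowr (ennreal \<bar>f x\<bar>) p * ennreal (\<sigma> x) \<partial>lebesgue"
    have "f \<in> borel_measurable lebesgue" using f by (simp add: in_Lp_def)
    moreover have "?F < top"
    proof (rule ccontr)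
      assume "\<not> ?F < top"
      then have "?F = top" by (metis less_top)
      with f show False by (simp add: in_Lp_def Lp_norm_def)
    qed
    ultimately have "(\<integral>\<^sup>+x. ennpowr (maximal_plus (\<lambda>y. f y * \<sigma> y) x) p * ennreal (w x) \<partial>lebesgue)
      \<le> ennreal c * (W_minus_const p \<sigma> \<Psi> * A_plus_const p w \<sigma> \<Phi>) * ?F"
      unfolding c_def using inv
      by (intro maximal_plus_two_weight[OF \<Phi> \<Psi> \<open>\<kappa> > 0\<close> _ \<open>p > 1\<close> w \<sigma>]) auto
    then have "Lp_norm p w (maximal_plus (\<lambda>x. f x * \<sigma> x))
      \<le> ennpowr (ennreal c * (W_minus_const p \<sigma> \<Psi> * A_plus_const p w \<sigma> \<Phi>) * ?F) (1 / p)"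
      unfolding Lp_norm_def using \<open>p > 1\<close> by (intro ennpowr_mono) simp_all
    also have "\<dots> = ennreal (c powr (1 / p)) * ennpowr (W_minus_const p \<sigma> \<Psi> * A_plus_const p w \<sigma> \<Phi>) (1 / p)
        * Lp_norm p \<sigma> (\<lambda>x. ennreal \<bar>f x\<bar>)"
      unfolding Lp_norm_def using \<open>p > 1\<close> c
      by (subst ennpowr_mult, simp, subst ennpowr_mult, simp, simp add: ennpowr_ennreal)
    finally show "Lp_norm p w (maximal_plus (\<lambda>x. f x * \<sigma> x))
             \<le> ennreal (c powr (1 / p)) * ennpowr (W_minus_const p \<sigma> \<Psi> * A_plus_const p w \<sigma> \<Phi>) (1 / p)
                 * Lp_norm p \<sigma> (\<lambda>x. ennreal \<bar>f x\<bar>)" .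
  qed
qed

end
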